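(* Let $g\in C^2([0,\infty))$ be a real-valued function such that, with constants $a_1,a_3,a_5>0$, $a_2,a_4\geq 0$ and for some exponent $\mu\geq 1$, $$g'(0)=0,\qquad g''(t)>0\quad\text{for } t>0,$$ $$a_1t-a_2\leq g(t)\leq a_3t+a_4\quad\text{for } t\geq 0,$$ $$g''(t)\leq a_5(1+t)^{-\mu}\quad\text{for } t\geq 0.$$ Let $F:\mathbb{R}^2\to\mathbb{R}$, $F(Z):=g(|Z|)$, and let $u:\mathbb{R}^2\to\mathbb{R}$ be a solution of class $C^2$ of $$\operatorname{div}\big[\nabla F(\nabla u)\big]=0\quad\text{on }\mathbb{R}^2 .$$ Then $u$ is an affine function provided that $\mu\geq 3$.
   Context: $|\cdot|$ denotes the Euclidean norm, $\nabla F$ is the gradient of $F$ on $\mathbb{R}^2$, and $\nabla u$ is the gradient of $u$. "Affine" means $u(x)=A\cdot x+a$ for some $A\in\mathbb{R}^2$ and $a\in\mathbb{R}$. *)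

theory Defs
  imports "HOL-Analysis.Analysis"
begin

definition grad :: "('a::euclidean_space \<Rightarrow> real) \<Rightarrow> 'a \<Rightarrow> 'a" where
  "grad f x = (THE D. GDERIV f x :> D)"

lemma grad_eqI:
  assumes "GDERIV f x :> D"
  shows "grad f x = D"
  unfolding grad_def
proof (rule the_equality)
  fix E assume "GDERIV f x :> E"
  with assms have "(\<lambda>h. h \<bullet> E) = (\<lambda>h. h \<bullet> D)"
    unfolding gderiv_def by (blast intro: has_derivative_unique)
  then show "E = D"
    by (metis vector_eq_ldot)
qed (fact assms)

definition divergence :: "('a::euclidean_space \<Rightarrow> 'a) \<Rightarrow> 'a \<Rightarrow> real" where
  "divergence V x = (\<Sum>b\<in>Basis. frechet_derivative V (at x) b \<bullet> b)"

text \<open>In finite dimension, continuity of the derivative in operator norm is the same as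
  continuity of all directional derivatives.\<close>

definition class_C1 :: "('a::euclidean_space \<Rightarrow> real) \<Rightarrow> bool" where
  "class_C1 f \<longleftrightarrow> (\<forall>x. f differentiable (at x)) \<and>
     (\<forall>h. continuous_on UNIV (\<lambda>x. frechet_derivative f (at x) h))"

definition class_C2 :: "('a::euclidean_space \<Rightarrow> real) \<Rightarrow> bool" where
  "class_C2 f \<longleftrightarrow> class_C1 f \<and> (\<forall>h. class_C1 (\<lambda>x. frechet_derivative f (at x) h))"

end

theory Submission
  imports Defs
begin

text \<open>
  The partial derivatives of \<open>u\<close> solve a linear equation in divergence form, and testing it with a
  bounded function of the partial derivative itself leads to a Caccioppoli inequality whose error
  term is controlled by the area of the graph.

  Write \<open>Z = \<nabla>u\<close>, \<open>t = \<bar>Z\<bar>\<close> and let \<open>H Z\<close> be the Hessian of the integrand, with eigenvalues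
  \<open>g'(t) / t\<close> (tangential) and \<open>g''(t)\<close> (radial). Differentiating the equation gives
  \<open>div (H Z (\<nabla> \<partial>\<^sub>e u)) = 0\<close> in the weak sense. The test function is \<open>\<eta>\<^sup>2 arctan (\<partial>\<^sub>e u)\<close>, where the
  cut-off \<open>\<eta>\<close> is a function of \<open>(\<bar>x\<bar>\<^sup>2 + u\<^sup>2) / R\<^sup>2\<close>, that is, of the distance in space and not in
  the plane. Its gradient is a multiple of \<open>x + u Z\<close>. In the direction of \<open>x\<close> the form \<open>H Z\<close> is of
  order \<open>\<bar>x\<bar>\<^sup>2 / (1 + t)\<close>, and in the direction of \<open>u Z\<close> it equals \<open>u\<^sup>2 t\<^sup>2 g''(t)\<close>, which is of order
  \<open>u\<^sup>2 / (1 + t)\<close> exactly because \<open>g''\<close> decays with exponent at least \<open>3\<close> (lemma \<open>H_radial_le\<close>). The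
  weight \<open>1 + (\<partial>\<^sub>e u)\<^sup>2\<close>, the reciprocal of the derivative of the arctangent, is at most \<open>(1 + t)\<^sup>2\<close>,
  so the error is bounded by \<open>R\<^sup>-\<^sup>2\<close> times the integral of \<open>1 + t\<close> over \<open>\<bar>x\<bar>\<^sup>2 + u\<^sup>2 \<le> 2 R\<^sup>2\<close>, up to
  constants. That integral is \<open>O(R\<^sup>2)\<close>, as one sees by testing the equation itself with a truncation
  of \<open>u\<close> (lemma \<open>area_growth\<close>); it is here that the dimension two is used.

  Hence the Dirichlet integral of \<open>\<partial>\<^sub>e u\<close> with weight \<open>1 / (1 + (\<partial>\<^sub>e u)\<^sup>2)\<close> is finite over the plane, and
  since the error term only sees the shell where \<open>\<nabla>\<eta>\<close> does not vanish, it is in fact zero (lemma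
  \<open>energy_zero\<close>). Thus \<open>D\<^sup>2u = 0\<close> wherever \<open>\<nabla>u \<noteq> 0\<close>, which implies that \<open>\<bar>\<nabla>u\<bar>\<^sup>2\<close> is constant and then
  that \<open>\<nabla>u\<close> is constant.
\<close>

section \<open>Integration by parts for compactly supported functions\<close>

text \<open>\<open>C1_grad f f'\<close> says that \<open>f\<close> is of class \<open>C\<^sup>1\<close> with gradient field \<open>f'\<close>.\<close>

definition C1_grad :: "('a::euclidean_space \<Rightarrow> real) \<Rightarrow> ('a \<Rightarrow> 'a) \<Rightarrow> bool" where
  "C1_grad f f' \<longleftrightarrow> (\<forall>x. GDERIV f x :> f' x) \<and> continuous_on UNIV f'"

text \<open>\<open>C1_field V DV\<close> says that \<open>V\<close> is a \<open>C\<^sup>1\<close> vector field with derivative \<open>DV x\<close> at \<open>x\<close>.\<close>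

definition C1_field :: "('a::euclidean_space \<Rightarrow> 'a) \<Rightarrow> ('a \<Rightarrow> 'a \<Rightarrow> 'a) \<Rightarrow> bool" where
  "C1_field V DV \<longleftrightarrow> (\<forall>x. (V has_derivative DV x) (at x)) \<and> (\<forall>h. continuous_on UNIV (\<lambda>x. DV x h))"

lemma C1_grad_continuous: "C1_grad f f' \<Longrightarrow> continuous_on UNIV f"
  unfolding C1_grad_def gderiv_def
  by (meson UNIV_I continuous_at_imp_continuous_on has_derivative_continuous)

lemma C1_field_continuous: "C1_field V DV \<Longrightarrow> continuous_on UNIV V"
  unfolding C1_field_def
  by (meson UNIV_I continuous_at_imp_continuous_on has_derivative_continuous)

lemma C1_grad_line:
  assumes "C1_grad f f'"
  shows "((\<lambda>s. f (x + s *\<^sub>R e)) has_real_derivative (f' (x + s *\<^sub>R e) \<bullet> e)) (at s)"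
proof -
  have "(f has_derivative (\<lambda>h. h \<bullet> f' (x + s *\<^sub>R e))) (at (x + s *\<^sub>R e))"
    using assms by (simp add: C1_grad_def gderiv_def)
  then have "((\<lambda>s. f (x + s *\<^sub>R e)) has_derivative (\<lambda>t. (t *\<^sub>R e) \<bullet> f' (x + s *\<^sub>R e))) (at s)"
    by (rule has_derivative_compose[rotated]) (auto intro!: derivative_eq_intros)
  then show ?thesis
    unfolding has_field_derivative_def
    by (rule has_derivative_eq_rhs) (auto simp: inner_commute)
qed

lemma C1_field_component:
  assumes "C1_field V DV"
  shows "C1_grad (\<lambda>x. V x \<bullet> b) (\<lambda>x. \<Sum>c\<in>Basis. (DV x c \<bullet> b) *\<^sub>R c)"
proof -
  have "GDERIV (\<lambda>x. V x \<bullet> b) x :> (\<Sum>c\<in>Basis. (DV x c \<bullet> b) *\<^sub>R c)" for x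
  proof -
    have D: "(V has_derivative DV x) (at x)"
      using assms by (simp add: C1_field_def)
    interpret bounded_linear "DV x" by (rule has_derivative_bounded_linear[OF D])
    have "h \<bullet> (\<Sum>c\<in>Basis. (DV x c \<bullet> b) *\<^sub>R c) = DV x h \<bullet> b" for h
    proof -
      have "DV x h \<bullet> b = DV x (\<Sum>c\<in>Basis. (h \<bullet> c) *\<^sub>R c) \<bullet> b"
        by (simp add: euclidean_representation)
      also have "\<dots> = (\<Sum>c\<in>Basis. (h \<bullet> c) * (DV x c \<bullet> b))"
        by (simp add: sum scaleR inner_sum_left)
      finally show ?thesis
        by (simp add: inner_sum_right mult.commute)
    qed
    then show ?thesis
      unfolding gderiv_def
      by (intro has_derivative_eq_rhs[OF has_derivative_inner_left[OF D]] ext) simp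
  qed
  moreover have "continuous_on UNIV (\<lambda>x. \<Sum>c\<in>Basis. (DV x c \<bullet> b) *\<^sub>R c)"
    using assms by (auto simp: C1_field_def intro!: continuous_intros)
  ultimately show ?thesis by (simp add: C1_grad_def)
qed

lemma C1_field_component_line:
  assumes "C1_field V DV"
  shows "((\<lambda>s. V (x + s *\<^sub>R e) \<bullet> b) has_real_derivative (DV (x + s *\<^sub>R e) e \<bullet> b)) (at s)"
proof -
  have "(V has_derivative DV (x + s *\<^sub>R e)) (at (x + s *\<^sub>R e))"
    using assms by (simp add: C1_field_def)
  then have *: "((\<lambda>s. V (x + s *\<^sub>R e)) has_derivative (\<lambda>t. DV (x + s *\<^sub>R e) (t *\<^sub>R e))) (at s)"
    by (rule has_derivative_compose[rotated]) (auto intro!: derivative_eq_intros)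
  have **: "((\<lambda>s. V (x + s *\<^sub>R e) \<bullet> b) has_derivative (\<lambda>t. DV (x + s *\<^sub>R e) (t *\<^sub>R e) \<bullet> b)) (at s)"
    by (rule has_derivative_inner_left[OF *])
  have "DV (x + s *\<^sub>R e) (t *\<^sub>R e) = t *\<^sub>R DV (x + s *\<^sub>R e) e" for t
    using assms unfolding C1_field_def
    by (metis has_derivative_bounded_linear bounded_linear.linear linear_scale)
  then have DV: "(\<lambda>t. DV (x + s *\<^sub>R e) (t *\<^sub>R e) \<bullet> b) = (*) (DV (x + s *\<^sub>R e) e \<bullet> b)"
    by (simp add: fun_eq_iff mult.commute)
  with ** show ?thesis
    unfolding has_field_derivative_def by simp
qed

lemma C1_grad_mult:
  assumes "C1_grad f f'" "C1_grad g g'"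
  shows "C1_grad (\<lambda>x. f x * g x) (\<lambda>x. f x *\<^sub>R g' x + g x *\<^sub>R f' x)"
  using assms C1_grad_continuous[OF assms(1)] C1_grad_continuous[OF assms(2)]
  by (auto simp: C1_grad_def intro!: GDERIV_mult continuous_intros)

lemma C1_grad_compose:
  fixes h h' :: "real \<Rightarrow> real"
  assumes "C1_grad f f'" "\<And>s. (h has_real_derivative h' s) (at s)" "continuous_on UNIV h'"
  shows "C1_grad (\<lambda>x. h (f x)) (\<lambda>x. h' (f x) *\<^sub>R f' x)"
proof -
  have "GDERIV (\<lambda>x. h (f x)) x :> h' (f x) *\<^sub>R f' x" for x
    using assms(1,2) by (intro GDERIV_DERIV_compose) (auto simp: C1_grad_def)
  moreover have "continuous_on UNIV (\<lambda>x. h' (f x) *\<^sub>R f' x)"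
    using assms(1) C1_grad_continuous[OF assms(1)] unfolding C1_grad_def
    by (intro continuous_intros continuous_on_compose2[OF assms(3)]) auto
  ultimately show ?thesis by (simp add: C1_grad_def)
qed

lemma C1_grad_translate:
  assumes "C1_grad f f'"
  shows "C1_grad (\<lambda>x. f (x + a)) (\<lambda>x. f' (x + a))"
proof -
  have "GDERIV (\<lambda>x. f (x + a)) x :> f' (x + a)" for x
  proof -
    have "(f has_derivative (\<lambda>h. h \<bullet> f' (x + a))) (at (x + a))"
      using assms by (simp add: C1_grad_def gderiv_def)
    then show ?thesis
      unfolding gderiv_def
      by (rule has_derivative_compose[rotated]) (auto intro!: derivative_eq_intros)
  qed
  moreover have "continuous_on UNIV (\<lambda>x. f' (x + a))"
    using assms unfolding C1_grad_def
    by (auto intro!: continuous_on_compose2[of UNIV f' UNIV] continuous_intros)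
  ultimately show ?thesis by (simp add: C1_grad_def)
qed

lemma C1_grad_zero_outside:
  assumes "C1_grad f f'" "\<And>x. norm x > R \<Longrightarrow> f x = 0" "norm x > R"
  shows "f' x = 0"
proof -
  have "open {x::'a. norm x > R}"
    by (intro open_Collect_less continuous_intros)
  moreover have "(f has_derivative (\<lambda>h. h \<bullet> f' x)) (at x)"
    using assms(1) by (simp add: C1_grad_def gderiv_def)
  ultimately have "((\<lambda>x. 0) has_derivative (\<lambda>h. h \<bullet> f' x)) (at x)"
    using has_derivative_transform_within_open[of f "\<lambda>h. h \<bullet> f' x" x UNIV "{x. norm x > R}" "\<lambda>x. 0"] assms(2,3)
    by simp
  then have "(\<lambda>h. h \<bullet> f' x) = (\<lambda>h. 0)"
    using has_derivative_unique has_derivative_const by blast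
  then show ?thesis
    by (metis inner_eq_zero_iff)
qed

lemma integrable_compact_support:
  fixes f :: "'a::euclidean_space \<Rightarrow> real"
  assumes "continuous_on UNIV f" "\<And>x. norm x > R \<Longrightarrow> f x = 0"
  shows "integrable lborel f"
proof -
  have "integrable lborel (\<lambda>x. indicator (cball 0 R) x *\<^sub>R f x)"
    using assms(1) by (intro borel_integrable_compact) (auto intro: continuous_on_subset)
  moreover have "(\<lambda>x. indicator (cball 0 R) x *\<^sub>R f x) = f"
    using assms(2) by (force simp: fun_eq_iff indicator_def)
  ultimately show ?thesis by simp
qed

lemma lborel_integral_translate:
  fixes f :: "'a::euclidean_space \<Rightarrow> real"
  assumes "continuous_on UNIV f"
  shows "(\<integral>x. f (x + a) \<partial>lborel) = (\<integral>x. f x \<partial>lborel)"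
proof -
  have "f \<in> borel_measurable borel"
    using assms by (rule borel_measurable_continuous_onI)
  then have "(\<integral>x. f x \<partial>distr lborel borel ((+) a)) = (\<integral>x. f (a + x) \<partial>lborel)"
    by (intro integral_distr) auto
  then show ?thesis
    by (simp add: lborel_distr_plus add.commute)
qed

text \<open>Differentiation under the integral sign against a compactly supported weight. Combined with
  the translation invariance of Lebesgue measure it replaces both the divergence theorem and
  mollification.\<close>

lemma integral_difference_quotient:
  fixes f d w :: "'a::euclidean_space \<Rightarrow> real"
  assumes f: "\<And>x s. ((\<lambda>s. f (x + s *\<^sub>R e)) has_real_derivative d (x + s *\<^sub>R e)) (at s)"
    and cont: "continuous_on UNIV f" "continuous_on UNIV d" "continuous_on UNIV w"
    and w: "\<And>x. norm x > R \<Longrightarrow> w x = 0"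
  shows "(\<lambda>n. \<integral>x. (f (x + inverse (real (Suc n)) *\<^sub>R e) - f x) * real (Suc n) * w x \<partial>lborel)
            \<longlonglongrightarrow> (\<integral>x. d x * w x \<partial>lborel)"
proof -
  have "bounded (d ` cball 0 (R + norm e))"
    using cont(2) by (intro compact_imp_bounded compact_continuous_image) 
      (auto intro: continuous_on_subset)
  then obtain M where M: "\<And>x. norm x \<le> R + norm e \<Longrightarrow> \<bar>d x\<bar> \<le> M"
    unfolding bounded_iff by (auto simp del: of_nat_Suc) (metis mem_cball_0)
  have bound: "\<bar>(f (x + inverse (real (Suc n)) *\<^sub>R e) - f x) * real (Suc n) * w x\<bar> \<le> M * \<bar>w x\<bar>" for x n
  proof (cases "norm x > R")
    case False
    let ?h = "inverse (real (Suc n))"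
    have h: "0 < ?h" "?h \<le> 1" by (auto simp: field_simps)
    obtain z where z: "z > 0" "z < ?h" and
      eq: "f (x + ?h *\<^sub>R e) - f (x + 0 *\<^sub>R e) = (?h - 0) * d (x + z *\<^sub>R e)"
      using MVT2[of 0 ?h "\<lambda>s. f (x + s *\<^sub>R e)" "\<lambda>s. d (x + s *\<^sub>R e)"] f h by auto
    have "norm (x + z *\<^sub>R e) \<le> R + 1 * norm e"
      using False z h
      by (intro norm_triangle_le add_mono, simp, unfold norm_scaleR, intro mult_right_mono) auto
    then have "\<bar>d (x + z *\<^sub>R e)\<bar> \<le> M" by (intro M) simp
    moreover have "(f (x + ?h *\<^sub>R e) - f x) * real (Suc n) = d (x + z *\<^sub>R e)"
      using eq by (simp add: field_simps)
    ultimately show ?thesis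
      by (simp add: abs_mult mult_right_mono)
  qed (simp add: w)
  have lim: "(\<lambda>n. (f (x + inverse (real (Suc n)) *\<^sub>R e) - f x) * real (Suc n) * w x) \<longlonglongrightarrow> d x * w x" for x
  proof -
    have "((\<lambda>h. (f (x + h *\<^sub>R e) - f x) / h) \<longlongrightarrow> d x) (at 0)"
      using f[of x 0] by (simp add: DERIV_def)
    moreover have "filterlim (\<lambda>n. inverse (real (Suc n))) (at 0) sequentially"
      unfolding filterlim_at using LIMSEQ_inverse_real_of_nat by simp
    ultimately have "(\<lambda>n. (f (x + inverse (real (Suc n)) *\<^sub>R e) - f x) / inverse (real (Suc n))) \<longlonglongrightarrow> d x"
      by (rule filterlim_compose)
    then show ?thesis
      by (intro tendsto_mult tendsto_const) (simp add: field_simps)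
  qed
  note [measurable] = borel_measurable_continuous_onI[OF cont(1)] borel_measurable_continuous_onI[OF cont(2)]
    borel_measurable_continuous_onI[OF cont(3)]
  show ?thesis
  proof (rule integral_dominated_convergence)
    show "integrable lborel (\<lambda>x. M * \<bar>w x\<bar>)"
      using cont(3) w by (intro integrable_compact_support[where R = R] continuous_intros) auto
  qed (use bound lim in auto)
qed

lemma integral_partial_derivative_zero:
  fixes p :: "'a::euclidean_space \<Rightarrow> real"
  assumes p: "C1_grad p p'" and supp: "\<And>x. norm x > R \<Longrightarrow> p x = 0"
  shows "(\<integral>x. p' x \<bullet> e \<partial>lborel) = 0"
proof -
  define S where "S = R + norm e"
  \<comment> \<open>A weight that is \<open>1\<close> on the supports of \<open>p\<close> and of its translates by \<open>- h e\<close>, \<open>0 < h \<le> 1\<close>.\<close>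
  define w where "w x = max 0 (min 1 (S + 1 - norm x))" for x :: 'a
  have contp: "continuous_on UNIV p" using C1_grad_continuous[OF p] .
  have lim: "(\<lambda>n. \<integral>x. (p (x + inverse (real (Suc n)) *\<^sub>R e) - p x) * real (Suc n) * w x \<partial>lborel)
            \<longlonglongrightarrow> (\<integral>x. (p' x \<bullet> e) * w x \<partial>lborel)"
    using p contp
    by (intro integral_difference_quotient[where R = "S + 1"])
       (auto simp: w_def C1_grad_def intro!: C1_grad_line continuous_intros)
  have "(\<integral>x. (p (x + inverse (real (Suc n)) *\<^sub>R e) - p x) * real (Suc n) * w x \<partial>lborel) = 0" for n
  proof -
    let ?h = "inverse (real (Suc n))"
    have "(p (x + ?h *\<^sub>R e) - p x) * w x = p (x + ?h *\<^sub>R e) - p x" for x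
    proof (cases "norm x \<le> S")
      case False
      have "norm x \<le> norm (x + ?h *\<^sub>R e) + norm (?h *\<^sub>R e)"
        by (metis add_diff_cancel_right' norm_triangle_ineq4)
      moreover have "norm (?h *\<^sub>R e) \<le> 1 * norm e"
        unfolding norm_scaleR by (intro mult_right_mono) (auto simp: field_simps)
      moreover have "norm e \<ge> 0" by simp
      ultimately have "norm (x + ?h *\<^sub>R e) > R" "norm x > R"
        using False unfolding S_def by linarith+
      then show ?thesis using supp by simp
    qed (simp add: w_def)
    then have quot: "(p (x + ?h *\<^sub>R e) - p x) * real (Suc n) * w x
        = real (Suc n) * (p (x + ?h *\<^sub>R e) - p x)" for x
      by (metis mult.assoc mult.commute)
    have "integrable lborel p"
      using contp supp by (rule integrable_compact_support)
    moreover have "integrable lborel (\<lambda>x. p (x + ?h *\<^sub>R e))"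
    proof (rule integrable_compact_support[where R = S])
      show "continuous_on UNIV (\<lambda>x. p (x + ?h *\<^sub>R e))"
        by (intro continuous_on_compose2[OF contp] continuous_intros) auto
      fix x :: 'a assume "norm x > S"
      moreover have "norm x \<le> norm (x + ?h *\<^sub>R e) + norm (?h *\<^sub>R e)"
        by (metis add_diff_cancel_right' norm_triangle_ineq4)
      moreover have "norm (?h *\<^sub>R e) \<le> 1 * norm e"
        unfolding norm_scaleR by (intro mult_right_mono) (auto simp: field_simps)
      ultimately show "p (x + ?h *\<^sub>R e) = 0"
        by (intro supp) (unfold S_def, linarith)
    qed
    moreover have "(\<integral>x. p (x + ?h *\<^sub>R e) \<partial>lborel) = (\<integral>x. p x \<partial>lborel)"
      by (rule lborel_integral_translate[OF contp])
    ultimately show ?thesis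
      unfolding quot by simp
  qed
  with lim have "(\<integral>x. (p' x \<bullet> e) * w x \<partial>lborel) = 0"
    by (simp add: LIMSEQ_const_iff)
  moreover have "(p' x \<bullet> e) * w x = p' x \<bullet> e" for x
  proof (cases "norm x \<le> S")
    case False
    then have "norm x > R" using norm_ge_zero[of e] unfolding S_def by linarith
    then show ?thesis using C1_grad_zero_outside[OF p supp] by simp
  qed (simp add: w_def)
  ultimately show ?thesis by simp
qed

text \<open>The weak form of \<open>div V = 0\<close>.\<close>

lemma integral_divergence_free:
  fixes V :: "'a::euclidean_space \<Rightarrow> 'a"
  assumes V: "C1_field V DV" and div: "\<And>x. (\<Sum>b\<in>Basis. DV x b \<bullet> b) = 0"
    and p: "C1_grad p p'" and supp: "\<And>x. norm x > R \<Longrightarrow> p x = 0"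
  shows "(\<integral>x. V x \<bullet> p' x \<partial>lborel) = 0"
proof -
  note conts = C1_grad_continuous[OF p] C1_field_continuous[OF V]
  have contDV: "continuous_on UNIV (\<lambda>x. DV x h)" for h
    using V by (simp add: C1_field_def)
  have contp': "continuous_on UNIV p'"
    using p by (simp add: C1_grad_def)
  note p'0 = C1_grad_zero_outside[OF p supp]
  let ?W = "\<lambda>b x. \<Sum>c\<in>Basis. (DV x c \<bullet> b) *\<^sub>R c"
  have "(\<integral>x. p x * (DV x b \<bullet> b) + (V x \<bullet> b) * (p' x \<bullet> b) \<partial>lborel) = 0" if b: "b \<in> Basis" for b
  proof -
    have "(\<integral>x. (p x *\<^sub>R ?W b x + (V x \<bullet> b) *\<^sub>R p' x) \<bullet> b \<partial>lborel) = 0"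
      by (rule integral_partial_derivative_zero[OF C1_grad_mult[OF p C1_field_component[OF V]], where R = R])
        (simp add: supp)
    moreover have "?W b x \<bullet> b = DV x b \<bullet> b" for x
      using b by (simp add: inner_sum_left inner_Basis if_distrib cong: if_cong)
    ultimately show ?thesis by (simp add: inner_add_left)
  qed
  then have "0 = (\<Sum>b\<in>Basis. (\<integral>x. p x * (DV x b \<bullet> b) + (V x \<bullet> b) * (p' x \<bullet> b) \<partial>lborel))"
    by simp
  also have "\<dots> = (\<integral>x. (\<Sum>b\<in>Basis. p x * (DV x b \<bullet> b) + (V x \<bullet> b) * (p' x \<bullet> b)) \<partial>lborel)"
    using conts contDV contp' supp p'0
    by (intro Bochner_Integration.integral_sum[symmetric] integrable_compact_support[where R = R])
       (auto intro!: continuous_intros)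
  also have "(\<lambda>x. \<Sum>b\<in>Basis. p x * (DV x b \<bullet> b) + (V x \<bullet> b) * (p' x \<bullet> b)) = (\<lambda>x. V x \<bullet> p' x)"
  proof
    fix x show "(\<Sum>b\<in>Basis. p x * (DV x b \<bullet> b) + (V x \<bullet> b) * (p' x \<bullet> b)) = V x \<bullet> p' x"
      unfolding euclidean_inner[of "V x" "p' x"]
      by (simp add: sum.distrib div flip: sum_distrib_left)
  qed
  finally show ?thesis by simp
qed

text \<open>The weak form of \<open>div (\<partial>\<^sub>e V) = 0\<close>: the identity for \<open>V\<close> is differentiated by means of
  difference quotients, since \<open>V\<close> is only of class \<open>C\<^sup>1\<close>.\<close>

lemma integral_derivative_divergence_free:
  fixes V :: "'a::euclidean_space \<Rightarrow> 'a"
  assumes V: "C1_field V DV" and div: "\<And>x. (\<Sum>b\<in>Basis. DV x b \<bullet> b) = 0"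
    and p: "C1_grad p p'" and supp: "\<And>x. norm x > R \<Longrightarrow> p x = 0"
  shows "(\<integral>x. DV x e \<bullet> p' x \<partial>lborel) = 0"
proof -
  note conts = C1_grad_continuous[OF p] C1_field_continuous[OF V]
  have contDV: "continuous_on UNIV (\<lambda>x. DV x h)" for h
    using V by (simp add: C1_field_def)
  have contp': "continuous_on UNIV p'"
    using p by (simp add: C1_grad_def)
  note p'0 = C1_grad_zero_outside[OF p supp]
  let ?D = "\<lambda>n b x. (V (x + inverse (real (Suc n)) *\<^sub>R e) \<bullet> b - V x \<bullet> b) * real (Suc n) * (p' x \<bullet> b)"
  have contVh: "continuous_on UNIV (\<lambda>x. V (x + a))" for a
    by (intro continuous_on_compose2[OF conts(2)] continuous_intros) auto
  have lim: "(\<lambda>n. \<Sum>b\<in>Basis. \<integral>x. ?D n b x \<partial>lborel)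
          \<longlonglongrightarrow> (\<Sum>b\<in>Basis. \<integral>x. (DV x e \<bullet> b) * (p' x \<bullet> b) \<partial>lborel)"
    using conts contDV contp' p'0
    by (intro tendsto_sum integral_difference_quotient[where R = R] C1_field_component_line V)
       (auto intro!: continuous_intros)
  have zero: "(\<Sum>b\<in>Basis. \<integral>x. ?D n b x \<partial>lborel) = 0" for n
  proof -
    define a where "a = inverse (real (Suc n)) *\<^sub>R e"
    have "(\<Sum>b\<in>Basis. \<integral>x. ?D n b x \<partial>lborel) = (\<integral>x. (\<Sum>b\<in>Basis. ?D n b x) \<partial>lborel)"
      using conts contVh contp' p'0
      by (intro Bochner_Integration.integral_sum[symmetric] integrable_compact_support[where R = R])
         (auto intro!: continuous_intros)
    also have "(\<lambda>x. \<Sum>b\<in>Basis. ?D n b x) = (\<lambda>x. real (Suc n) * (V (x + a) \<bullet> p' x - V x \<bullet> p' x))"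
    proof
      fix x show "(\<Sum>b\<in>Basis. ?D n b x) = real (Suc n) * (V (x + a) \<bullet> p' x - V x \<bullet> p' x)"
        unfolding a_def[symmetric] euclidean_inner[of "V x" "p' x"] euclidean_inner[of "V (x + a)" "p' x"]
          sum_subtractf[symmetric] sum_distrib_left
        by (intro sum.cong refl) (simp only: algebra_simps)
    qed
    also have "(\<integral>x. real (Suc n) * (V (x + a) \<bullet> p' x - V x \<bullet> p' x) \<partial>lborel)
        = real (Suc n) * ((\<integral>x. V (x + a) \<bullet> p' x \<partial>lborel) - (\<integral>x. V x \<bullet> p' x \<partial>lborel))"
      using conts contVh contp' p'0
      by (subst Bochner_Integration.integral_diff[symmetric])
         (auto intro!: continuous_intros integrable_compact_support[where R = R] simp del: of_nat_Suc)
    also have "(\<integral>x. V x \<bullet> p' x \<partial>lborel) = 0"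
      by (rule integral_divergence_free[OF V div p supp])
    also have "(\<integral>x. V (x + a) \<bullet> p' x \<partial>lborel) = (\<integral>x. V (x + a) \<bullet> p' ((x + a) + - a) \<partial>lborel)"
      by simp
    also have "\<dots> = (\<integral>x. V x \<bullet> p' (x + - a) \<partial>lborel)"
      by (intro lborel_integral_translate[of "\<lambda>x. V x \<bullet> p' (x + - a)"] continuous_intros conts
            continuous_on_compose2[OF contp']) auto
    also have "\<dots> = 0"
    proof (rule integral_divergence_free[OF V div C1_grad_translate[OF p], where R = "R + norm a"])
      fix x :: 'a assume "norm x > R + norm a"
      moreover have "norm x \<le> norm (x + - a) + norm a"
        by (metis diff_add_cancel norm_triangle_ineq add_uminus_conv_diff)
      ultimately show "p (x + - a) = 0"
        by (intro supp) linarith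
    qed
    finally show ?thesis by simp
  qed
  from lim have "(\<Sum>b\<in>Basis. \<integral>x. (DV x e \<bullet> b) * (p' x \<bullet> b) \<partial>lborel) = 0"
    unfolding zero by (simp add: LIMSEQ_const_iff)
  also have "(\<Sum>b\<in>Basis. \<integral>x. (DV x e \<bullet> b) * (p' x \<bullet> b) \<partial>lborel)
      = (\<integral>x. (\<Sum>b\<in>Basis. (DV x e \<bullet> b) * (p' x \<bullet> b)) \<partial>lborel)"
    using contDV contp' p'0
    by (intro Bochner_Integration.integral_sum[symmetric] integrable_compact_support[where R = R])
       (auto intro!: continuous_intros)
  also have "(\<lambda>x. \<Sum>b\<in>Basis. (DV x e \<bullet> b) * (p' x \<bullet> b)) = (\<lambda>x. DV x e \<bullet> p' x)"
    by (intro ext euclidean_inner[symmetric])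
  finally show ?thesis .
qed

lemma continuous_integral_zero:
  fixes f :: "'a::euclidean_space \<Rightarrow> real"
  assumes "continuous_on UNIV f" "\<And>x. f x \<ge> 0" "\<And>x. norm x > R \<Longrightarrow> f x = 0"
    "(\<integral>x. f x \<partial>lborel) = 0"
  shows "f x = 0"
proof -
  have "AE x in lborel. f x = 0"
    using integral_nonneg_eq_0_iff_AE[OF integrable_compact_support[OF assms(1,3)]] assms(2,4) by simp
  then have "AE x in lebesgue. f x = 0"
    by (rule AE_completion)
  then have "{x. f x \<noteq> 0} \<in> null_sets lebesgue"
    by (simp add: AE_iff_null_sets eventually_ae_filter)
       (metis (mono_tags, lifting) completion.complete2 mem_Collect_eq subsetI)
  then have "negligible {x. f x \<noteq> 0}"
    by (simp add: negligible_iff_null_sets)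
  moreover have "open {x. f x \<noteq> 0}"
    using assms(1) by (intro open_Collect_neq continuous_intros)
  ultimately show ?thesis
    using open_not_negligible by blast
qed

section \<open>Second derivatives\<close>

text \<open>By applying the mean value theorem in each of the two directions, a second difference is
  expressed through one of the two mixed second derivatives. Exchanging the directions and letting
  the step tend to \<open>0\<close> gives the symmetry of the Hessian.\<close>

lemma second_difference:
  fixes u :: "'a::euclidean_space \<Rightarrow> real"
  assumes u: "C1_grad u Z" and Z: "C1_field Z D" and "h > 0"
  shows "\<exists>s t. 0 < s \<and> s < h \<and> 0 < t \<and> t < h \<and>
    u (x + h *\<^sub>R e + h *\<^sub>R b) - u (x + h *\<^sub>R e) - u (x + h *\<^sub>R b) + u x
      = h * h * (D (x + s *\<^sub>R e + t *\<^sub>R b) b \<bullet> e)"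
proof -
  let ?f = "\<lambda>s. u ((x + h *\<^sub>R b) + s *\<^sub>R e) - u (x + s *\<^sub>R e)"
  have f: "(?f has_real_derivative (Z ((x + h *\<^sub>R b) + s *\<^sub>R e) \<bullet> e - Z (x + s *\<^sub>R e) \<bullet> e)) (at s)" for s
    by (intro DERIV_diff C1_grad_line u)
  obtain s where s: "0 < s" "s < h"
    and fs: "?f h - ?f 0 = (h - 0) * (Z ((x + h *\<^sub>R b) + s *\<^sub>R e) \<bullet> e - Z (x + s *\<^sub>R e) \<bullet> e)"
    using MVT2[OF \<open>h > 0\<close>, of ?f "\<lambda>s. Z ((x + h *\<^sub>R b) + s *\<^sub>R e) \<bullet> e - Z (x + s *\<^sub>R e) \<bullet> e"] f
    by blast
  obtain t where t: "0 < t" "t < h"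
    and ft: "Z ((x + s *\<^sub>R e) + h *\<^sub>R b) \<bullet> e - Z ((x + s *\<^sub>R e) + 0 *\<^sub>R b) \<bullet> e
      = (h - 0) * (D ((x + s *\<^sub>R e) + t *\<^sub>R b) b \<bullet> e)"
    using MVT2[OF \<open>h > 0\<close>, of "\<lambda>t. Z ((x + s *\<^sub>R e) + t *\<^sub>R b) \<bullet> e" "\<lambda>t. D ((x + s *\<^sub>R e) + t *\<^sub>R b) b \<bullet> e"]
      C1_field_component_line[OF Z] by blast
  have eqs: "(x + h *\<^sub>R b) + s *\<^sub>R e = (x + s *\<^sub>R e) + h *\<^sub>R b" "(x + h *\<^sub>R b) + h *\<^sub>R e = (x + h *\<^sub>R e) + h *\<^sub>R b"
    by simp_all
  show ?thesis
    using s t fs ft unfolding eqs by (intro exI[of _ s] exI[of _ t]) (simp add: algebra_simps)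
qed

lemma hessian_symmetric:
  fixes u :: "'a::euclidean_space \<Rightarrow> real"
  assumes u: "C1_grad u Z" and Z: "C1_field Z D"
  shows "D x e \<bullet> b = D x b \<bullet> e"
proof -
  define h where "h n = inverse (real (Suc n))" for n
  define q where "q n = (u (x + h n *\<^sub>R e + h n *\<^sub>R b) - u (x + h n *\<^sub>R e) - u (x + h n *\<^sub>R b) + u x) / (h n * h n)" for n
  have h0: "h n > 0" for n by (simp add: h_def)
  have hlim: "h \<longlonglongrightarrow> 0"
    unfolding h_def by (rule LIMSEQ_inverse_real_of_nat)
  have lim: "r \<longlonglongrightarrow> D x c \<bullet> a"
    if r: "\<And>n. \<exists>s t. 0 < s \<and> s < h n \<and> 0 < t \<and> t < h n \<and> r n = D (x + s *\<^sub>R a + t *\<^sub>R c) c \<bullet> a" for r a c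
  proof -
    obtain s t where st: "\<And>n. 0 < s n" "\<And>n. s n < h n" "\<And>n. 0 < t n" "\<And>n. t n < h n"
      "\<And>n. r n = D (x + s n *\<^sub>R a + t n *\<^sub>R c) c \<bullet> a"
      using r by metis
    have "s \<longlonglongrightarrow> 0"
      by (rule tendsto_sandwich[OF _ _ tendsto_const hlim]) (auto intro!: always_eventually less_imp_le st)
    moreover have "t \<longlonglongrightarrow> 0"
      by (rule tendsto_sandwich[OF _ _ tendsto_const hlim]) (auto intro!: always_eventually less_imp_le st)
    ultimately have "(\<lambda>n. x + s n *\<^sub>R a + t n *\<^sub>R c) \<longlonglongrightarrow> x + 0 *\<^sub>R a + 0 *\<^sub>R c"
      by (intro tendsto_intros)
    moreover have "continuous_on UNIV (\<lambda>x. D x c)"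
      using Z by (simp add: C1_field_def)
    ultimately have "(\<lambda>n. D (x + s n *\<^sub>R a + t n *\<^sub>R c) c) \<longlonglongrightarrow> D x c"
      using continuous_on_tendsto_compose by fastforce
    then show ?thesis
      unfolding st(5) by (intro tendsto_intros)
  qed
  have "q \<longlonglongrightarrow> D x b \<bullet> e"
  proof (rule lim)
    fix n
    from second_difference[OF u Z h0[of n], of x e b]
    show "\<exists>s t. 0 < s \<and> s < h n \<and> 0 < t \<and> t < h n \<and> q n = D (x + s *\<^sub>R e + t *\<^sub>R b) b \<bullet> e"
      unfolding q_def using h0[of n] by fastforce
  qed
  moreover have "q \<longlonglongrightarrow> D x e \<bullet> b"
  proof (rule lim)
    fix n
    have "u (x + h n *\<^sub>R e + h n *\<^sub>R b) - u (x + h n *\<^sub>R e) - u (x + h n *\<^sub>R b) + u x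
      = u (x + h n *\<^sub>R b + h n *\<^sub>R e) - u (x + h n *\<^sub>R b) - u (x + h n *\<^sub>R e) + u x"
      by (simp add: algebra_simps)
    with second_difference[OF u Z h0[of n], of x b e]
    show "\<exists>s t. 0 < s \<and> s < h n \<and> 0 < t \<and> t < h n \<and> q n = D (x + s *\<^sub>R b + t *\<^sub>R e) e \<bullet> b"
      unfolding q_def using h0[of n] by fastforce
  qed
  ultimately show ?thesis by (rule LIMSEQ_unique[symmetric])
qed

lemma C1_grad_partial:
  fixes u :: "'a::euclidean_space \<Rightarrow> real"
  assumes u: "C1_grad u Z" and Z: "C1_field Z D"
  shows "C1_grad (\<lambda>x. Z x \<bullet> e) (\<lambda>x. D x e)"
proof -
  have "(\<Sum>c\<in>Basis. (D x c \<bullet> e) *\<^sub>R c) = D x e" for x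
    unfolding hessian_symmetric[OF u Z, of x _ e] by (rule euclidean_representation)
  with C1_field_component[OF Z, of e] show ?thesis by simp
qed

lemma class_C2_gradient_hessian:
  fixes u :: "'a::euclidean_space \<Rightarrow> real"
  assumes "class_C2 u"
  obtains Z D where "C1_grad u Z" "C1_field Z D"
proof -
  let ?d = "\<lambda>b x. frechet_derivative u (at x) b"
  define Z where "Z x = (\<Sum>b\<in>Basis. ?d b x *\<^sub>R b)" for x
  define D where "D x h = (\<Sum>b\<in>Basis. frechet_derivative (?d b) (at x) h *\<^sub>R b)" for x h
  have C1: "class_C1 u" "\<And>b. class_C1 (?d b)"
    using assms by (auto simp: class_C2_def)
  have "GDERIV u x :> Z x" for x
  proof -
    have ux: "(u has_derivative frechet_derivative u (at x)) (at x)"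
      using C1(1) by (simp add: class_C1_def frechet_derivative_works)
    interpret bounded_linear "frechet_derivative u (at x)"
      by (rule has_derivative_bounded_linear[OF ux])
    have "frechet_derivative u (at x) h = h \<bullet> Z x" for h
    proof -
      have "frechet_derivative u (at x) h = frechet_derivative u (at x) (\<Sum>b\<in>Basis. (h \<bullet> b) *\<^sub>R b)"
        by (simp add: euclidean_representation)
      also have "\<dots> = h \<bullet> Z x"
        by (simp add: sum scaleR Z_def inner_sum_right mult.commute)
      finally show ?thesis .
    qed
    then have "frechet_derivative u (at x) = (\<lambda>h. h \<bullet> Z x)"
      by auto
    with ux show ?thesis by (simp add: gderiv_def)
  qed
  moreover have "continuous_on UNIV Z"
    unfolding Z_def using C1(1) by (auto simp: class_C1_def intro!: continuous_intros)
  ultimately have "C1_grad u Z" by (simp add: C1_grad_def)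
  moreover have "(Z has_derivative D x) (at x)" for x
  proof -
    have "((\<lambda>x. \<Sum>b\<in>Basis. ?d b x *\<^sub>R b) has_derivative
        (\<lambda>h. \<Sum>b\<in>Basis. frechet_derivative (?d b) (at x) h *\<^sub>R b)) (at x)"
    proof (intro has_derivative_sum has_derivative_scaleR_left)
      fix b show "(?d b has_derivative frechet_derivative (?d b) (at x)) (at x)"
        using C1(2)[of b] by (simp add: class_C1_def frechet_derivative_works)
    qed
    then show ?thesis by (simp add: Z_def[abs_def] D_def[abs_def])
  qed
  moreover have "continuous_on UNIV (\<lambda>x. D x h)" for h
    unfolding D_def using C1(2) by (auto simp: class_C1_def intro!: continuous_intros)
  ultimately show thesis by (intro that[of Z D]) (simp_all add: C1_field_def)
qed

section \<open>Radial integrands of linear growth\<close>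

text \<open>The integrand is \<open>F Z = g \<bar>Z\<bar>\<close>, and \<open>g1\<close>, \<open>g2\<close> stand for \<open>g'\<close>, \<open>g''\<close>. The
  decay of \<open>g''\<close> is required with the critical exponent \<open>3\<close>.\<close>

locale radial_integrand =
  fixes g1 g2 :: "real \<Rightarrow> real" and c :: real
  assumes g1_deriv: "\<And>t. t \<ge> 0 \<Longrightarrow> (g1 has_real_derivative g2 t) (at t within {0..})"
    and g2_cont: "continuous_on {0..} g2"
    and g1_0: "g1 0 = 0"
    and g2_pos: "\<And>t. t > 0 \<Longrightarrow> g2 t > 0"
    and g2_le: "\<And>t. t \<ge> 0 \<Longrightarrow> g2 t \<le> c / (1 + t) ^ 3"
begin

text \<open>The tangential eigenvalue \<open>g'(t) / t\<close> of the Hessian of the integrand, extended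
  continuously to \<open>t = 0\<close>.\<close>

definition k :: "real \<Rightarrow> real" where
  "k t = (if t = 0 then g2 0 else g1 t / t)"

text \<open>The gradient of the integrand.\<close>

definition G :: "'a::euclidean_space \<Rightarrow> 'a" where
  "G Z = k (norm Z) *\<^sub>R Z"

text \<open>The Hessian of the integrand at \<open>Z\<close>, applied to \<open>X\<close>. At \<open>Z = 0\<close> the last term vanishes.\<close>

definition H :: "'a::euclidean_space \<Rightarrow> 'a \<Rightarrow> 'a" where
  "H Z X = k (norm Z) *\<^sub>R X + ((g2 (norm Z) - k (norm Z)) * (Z \<bullet> X) / (norm Z)\<^sup>2) *\<^sub>R Z"

lemma c_pos: "c > 0"
  using g2_pos[of 1] g2_le[of 1] by simp

lemma g2_nonneg: "t \<ge> 0 \<Longrightarrow> g2 t \<ge> 0"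
proof -
  have "g2 0 \<ge> 0"
  proof (rule tendsto_lowerbound)
    show "(g2 \<longlongrightarrow> g2 0) (at_right 0)"
      using g2_cont by (auto simp: continuous_on intro: tendsto_within_subset)
    show "eventually (\<lambda>t. 0 \<le> g2 t) (at_right 0)"
      by (auto simp: eventually_at_filter intro!: always_eventually less_imp_le g2_pos)
  qed simp
  then show "t \<ge> 0 \<Longrightarrow> g2 t \<ge> 0"
    using g2_pos[of t] by (cases "t = 0") auto
qed

lemma g1_deriv_at: "t > 0 \<Longrightarrow> (g1 has_real_derivative g2 t) (at t)"
  using g1_deriv[of t] at_within_interior[of t "{0..}"] by (simp add: interior_Ici[of "-1"])

lemma g1_cont: "continuous_on {0..} g1"
  using g1_deriv by (auto intro!: continuous_on_eq_continuous_within[THEN iffD2] DERIV_continuous)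

lemma g1_less: "0 \<le> s \<Longrightarrow> s < t \<Longrightarrow> g1 s < g1 t"
  using g1_cont
  by (intro DERIV_pos_imp_increasing_open[of s t g1])
     (auto intro!: g1_deriv_at g2_pos exI[of _ "g2 _"] intro: continuous_on_subset)

lemma g1_pos: "t > 0 \<Longrightarrow> g1 t > 0"
  using g1_less[of 0 t] g1_0 by simp

text \<open>The comparison function \<open>c t / (1 + t)\<close> gives at once that \<open>g'\<close> is bounded and that the
  tangential eigenvalue decays like \<open>1 / (1 + t)\<close>.\<close>

lemma g1_le:
  assumes "t \<ge> 0"
  shows "g1 t \<le> c * t / (1 + t)"
proof -
  have "(\<lambda>t. c * t / (1 + t) - g1 t) 0 \<le> (\<lambda>t. c * t / (1 + t) - g1 t) t"
  proof (rule DERIV_nonneg_imp_increasing_open[OF assms])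
    fix x :: real assume x: "0 < x" "x < t"
    have "((\<lambda>t. c * t / (1 + t) - g1 t) has_real_derivative c / (1 + x)^2 - g2 x) (at x)"
      using x by (auto intro!: derivative_eq_intros g1_deriv_at simp: field_simps power2_eq_square)
    moreover have "c / (1 + x) ^ 3 \<le> c / (1 + x)^2"
      using x c_pos by (intro divide_left_mono power_increasing) auto
    then have "0 \<le> c / (1 + x)^2 - g2 x"
      using g2_le[of x] x by simp
    ultimately show "\<exists>y. ((\<lambda>t. c * t / (1 + t) - g1 t) has_real_derivative y) (at x) \<and> 0 \<le> y"
      by blast
  next
    show "continuous_on {0..t} (\<lambda>t. c * t / (1 + t) - g1 t)"
      by (auto intro!: continuous_intros continuous_on_subset[OF g1_cont])
  qed
  then show ?thesis by (simp add: g1_0)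
qed

lemma g1_le_c: "t \<ge> 0 \<Longrightarrow> g1 t \<le> c"
  using g1_le[of t] c_pos
  by (rule_tac order_trans[of _ "c * t / (1 + t)"]) (auto simp: field_simps)

lemma g2_le': "t \<ge> 0 \<Longrightarrow> g2 t \<le> c / (1 + t)"
proof -
  assume t: "t \<ge> 0"
  have "c / (1 + t) ^ 3 \<le> c / (1 + t) ^ 1"
    using t c_pos by (intro divide_left_mono power_increasing) auto
  then show ?thesis using g2_le[OF t] by simp
qed

lemma k_nonneg: "t \<ge> 0 \<Longrightarrow> k t \<ge> 0"
  using g1_pos[of t] g2_nonneg[of 0] by (auto simp: k_def)

lemma k_pos: "t > 0 \<Longrightarrow> k t > 0"
  using g1_pos[of t] by (auto simp: k_def)

lemma k_le: "t \<ge> 0 \<Longrightarrow> k t \<le> c / (1 + t)"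
proof (cases "t = 0")
  case True
  then show ?thesis using g2_le[of 0] by (simp add: k_def)
next
  case False
  assume "t \<ge> 0"
  with False show ?thesis
    using g1_le[of t] by (simp add: k_def field_simps)
qed

lemma k_mult: "t \<ge> 0 \<Longrightarrow> k t * t = g1 t"
  by (auto simp: k_def g1_0)

lemma norm_G: "norm (G Z) \<le> c"
  using g1_le_c[of "norm Z"] k_nonneg[of "norm Z"] k_mult[of "norm Z"] by (simp add: G_def)

lemma G_inner: "G Z \<bullet> Z = g1 (norm Z) * norm Z"
  using k_mult[of "norm Z"] by (simp add: G_def dot_square_norm power2_eq_square)

lemma linear_H: "linear (H Z)"
  by (rule linearI)
     (simp_all add: H_def inner_add_right distrib_left add_divide_distrib scaleR_add_left scaleR_add_right mult.left_commute)

lemma H_inner: "H Z X \<bullet> Y = k (norm Z) * (X \<bullet> Y) + (g2 (norm Z) - k (norm Z)) * (Z \<bullet> X) * (Z \<bullet> Y) / (norm Z)\<^sup>2"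
  by (simp add: H_def inner_add_left)

lemma H_sym: "H Z X \<bullet> Y = H Z Y \<bullet> X"
  unfolding H_inner by (simp add: inner_commute[of X Y] mult.assoc mult.commute[of "Z \<bullet> X"])

text \<open>Here \<open>q\<close> is the squared length of the radial part of \<open>X\<close> and \<open>p\<close> that of the tangential part.\<close>

lemma H_quadratic:
  obtains p q where "p \<ge> 0" "q \<ge> 0" "p + q = (norm X)\<^sup>2"
    "H Z X \<bullet> X = k (norm Z) * p + g2 (norm Z) * q"
proof -
  let ?q = "(Z \<bullet> X)\<^sup>2 / (norm Z)\<^sup>2"
  have "(Z \<bullet> X)\<^sup>2 \<le> (norm Z)\<^sup>2 * (norm X)\<^sup>2"
    using Cauchy_Schwarz_ineq[of Z X] by (simp add: dot_square_norm)
  then have "(norm X)\<^sup>2 - ?q \<ge> 0"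
    by (cases "Z = 0") (auto simp: field_simps)
  moreover have "H Z X \<bullet> X = k (norm Z) * ((norm X)\<^sup>2 - ?q) + g2 (norm Z) * ?q"
    by (simp add: H_inner dot_square_norm algebra_simps add_divide_distrib diff_divide_distrib power2_eq_square)
  ultimately show ?thesis
    by (intro that[of "(norm X)\<^sup>2 - ?q" ?q]) simp_all
qed

lemma H_nonneg: "H Z X \<bullet> X \<ge> 0"
  using k_nonneg[of "norm Z"] g2_nonneg[of "norm Z"]
  by (rule_tac H_quadratic[of X Z]) (auto intro!: add_nonneg_nonneg mult_nonneg_nonneg)

lemma H_pos:
  assumes "Z \<noteq> 0" "H Z X \<bullet> X = 0"
  shows "X = 0"
proof (rule H_quadratic[of X Z])
  fix p q :: real
  assume pq: "p \<ge> 0" "q \<ge> 0" "p + q = (norm X)\<^sup>2" "H Z X \<bullet> X = k (norm Z) * p + g2 (norm Z) * q"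
  have pos: "k (norm Z) > 0" "g2 (norm Z) > 0"
    using assms(1) by (auto intro: k_pos g2_pos)
  have "k (norm Z) * p = 0" "g2 (norm Z) * q = 0"
    using pq assms(2) pos by (smt (verit) mult_nonneg_nonneg)+
  then show ?thesis using pos pq by auto
qed

lemma H_le: "H Z X \<bullet> X \<le> c / (1 + norm Z) * (norm X)\<^sup>2"
proof (rule H_quadratic[of X Z])
  fix p q :: real
  assume pq: "p \<ge> 0" "q \<ge> 0" "p + q = (norm X)\<^sup>2" "H Z X \<bullet> X = k (norm Z) * p + g2 (norm Z) * q"
  have "k (norm Z) * p + g2 (norm Z) * q \<le> c / (1 + norm Z) * p + c / (1 + norm Z) * q"
    using pq by (intro add_mono mult_right_mono k_le g2_le') auto
  then show ?thesis unfolding pq(4) pq(3)[symmetric] by (simp only: distrib_left)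
qed

text \<open>In the radial direction the decay of \<open>g''\<close> makes up for the factor \<open>\<bar>Z\<bar>\<^sup>2\<close>.\<close>

lemma H_self_le: "H Z Z \<bullet> Z \<le> c / (1 + norm Z)"
proof -
  let ?t = "norm Z"
  have "H Z Z \<bullet> Z = g2 ?t * ?t\<^sup>2"
    by (cases "Z = 0") (simp_all add: H_inner dot_square_norm field_simps power2_eq_square)
  also have "\<dots> \<le> c / (1 + ?t)^3 * (1 + ?t)\<^sup>2"
    using g2_nonneg[of ?t] c_pos by (intro mult_mono g2_le power_mono) auto
  also have "\<dots> = c / (1 + ?t)"
    by (simp add: power3_eq_cube power2_eq_square add_nonneg_eq_0_iff)
  finally show ?thesis .
qed

lemma H_Young:
  assumes "\<epsilon> > 0"
  shows "2 * \<bar>H Z X \<bullet> Y\<bar> \<le> \<epsilon> * (H Z X \<bullet> X) + (H Z Y \<bullet> Y) / \<epsilon>"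
proof -
  interpret linear "H Z" by (rule linear_H)
  have "0 \<le> \<epsilon>\<^sup>2 * (H Z X \<bullet> X) + 2 * s * \<epsilon> * (H Z X \<bullet> Y) + s\<^sup>2 * (H Z Y \<bullet> Y)" for s
    using H_nonneg[of Z "\<epsilon> *\<^sub>R X + s *\<^sub>R Y"] H_sym[of Z X Y]
    by (simp add: add scale inner_add_left inner_add_right power2_eq_square algebra_simps)
  from this[of 1] this[of "-1"]
  have "2 * \<epsilon> * \<bar>H Z X \<bullet> Y\<bar> \<le> \<epsilon>\<^sup>2 * (H Z X \<bullet> X) + (H Z Y \<bullet> Y)"
    by (auto simp: abs_if)
  then show ?thesis
    using assms by (simp add: field_simps power2_eq_square)
qed

text \<open>The vector \<open>x + r Z\<close> is half the gradient of \<open>\<bar>x\<bar>\<^sup>2 + u\<^sup>2\<close> if \<open>u = r\<close> and \<open>\<nabla>u = Z\<close> at \<open>x\<close>.\<close>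

lemma H_radial_le: "H Z (x + r *\<^sub>R Z) \<bullet> (x + r *\<^sub>R Z) \<le> 2 * c * ((norm x)\<^sup>2 + r\<^sup>2) / (1 + norm Z)"
proof -
  interpret linear "H Z" by (rule linear_H)
  have "H Z (x + r *\<^sub>R Z) \<bullet> (x + r *\<^sub>R Z) \<le> 2 * (H Z x \<bullet> x) + 2 * (r\<^sup>2 * (H Z Z \<bullet> Z))"
    using H_nonneg[of Z "x - r *\<^sub>R Z"] H_sym[of Z x Z]
    by (simp add: add diff scale inner_simps power2_eq_square algebra_simps)
  also have "\<dots> \<le> 2 * (c / (1 + norm Z) * (norm x)\<^sup>2) + 2 * (r\<^sup>2 * (c / (1 + norm Z)))"
    by (intro add_mono mult_left_mono H_le H_self_le) auto
  also have "\<dots> = 2 * c * ((norm x)\<^sup>2 + r\<^sup>2) / (1 + norm Z)"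
    by (simp add: field_simps add_nonneg_eq_0_iff)
  finally show ?thesis .
qed

lemma k_cont: "continuous_on {0..} k"
  unfolding continuous_on_eq_continuous_within
proof
  fix t :: real assume t: "t \<in> {0..}"
  show "continuous (at t within {0..}) k"
  proof (cases "t = 0")
    case True
    have "((\<lambda>y. (g1 y - g1 0) / (y - 0)) \<longlongrightarrow> g2 0) (at 0 within {0..})"
      using g1_deriv[of 0] by (simp add: has_field_derivative_iff)
    then have "(k \<longlongrightarrow> g2 0) (at 0 within {0..})"
      by (rule Lim_transform_eventually) (auto simp: eventually_at_filter k_def g1_0)
    then show ?thesis
      using True by (simp add: continuous_within k_def)
  next
    case False
    then have "isCont (\<lambda>t. g1 t / t) t"
      using t by (intro continuous_intros DERIV_isCont[OF g1_deriv_at]) auto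
    moreover have "eventually (\<lambda>y. y \<in> {0<..}) (nhds t)"
      using t False by (intro eventually_nhds_in_open) auto
    then have "eventually (\<lambda>y. g1 y / y = k y) (nhds t)"
      by (rule eventually_mono) (simp add: k_def)
    ultimately have "isCont k t"
      using isCont_cong[of "\<lambda>y. g1 y / y" k t] by simp
    then show ?thesis by (rule continuous_at_imp_continuous_at_within)
  qed
qed

lemma continuous_k_norm: "continuous_on S Z \<Longrightarrow> continuous_on S (\<lambda>x. k (norm (Z x)))"
  by (intro continuous_on_compose2[OF k_cont] continuous_intros) auto

lemma continuous_g1_norm: "continuous_on S Z \<Longrightarrow> continuous_on S (\<lambda>x. g1 (norm (Z x)))"
  by (intro continuous_on_compose2[OF g1_cont] continuous_intros) auto

lemma continuous_g2_norm: "continuous_on S Z \<Longrightarrow> continuous_on S (\<lambda>x. g2 (norm (Z x)))"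
  by (intro continuous_on_compose2[OF g2_cont] continuous_intros) auto

lemma continuous_H:
  fixes Z X :: "'b::t2_space \<Rightarrow> 'a::euclidean_space"
  assumes Z: "continuous_on UNIV Z" and X: "continuous_on UNIV X"
  shows "continuous_on UNIV (\<lambda>x. H (Z x) (X x))"
proof -
  define m where "m x = g2 (norm (Z x)) - k (norm (Z x))" for x
  let ?R = "\<lambda>x. (m x * (Z x \<bullet> X x) / (norm (Z x))\<^sup>2) *\<^sub>R Z x"
  have m: "continuous_on UNIV m"
    unfolding m_def by (intro continuous_intros continuous_k_norm continuous_g2_norm Z)
  have "isCont ?R x" for x
  proof (cases "Z x = 0")
    case False
    moreover have "isCont Z x" "isCont X x" "isCont m x"
      using Z X m by (auto simp: continuous_on_eq_continuous_at)
    ultimately show ?thesis by (intro continuous_intros) auto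
  next
    case True
    have "((\<lambda>y. \<bar>m y\<bar> * norm (X y)) \<longlongrightarrow> \<bar>m x\<bar> * norm (X x)) (at x)"
      using X m by (intro tendsto_intros) (auto simp: continuous_on_def)
    then have "((\<lambda>y. \<bar>m y\<bar> * norm (X y)) \<longlongrightarrow> 0) (at x)"
      using True by (simp add: m_def k_def)
    then have "(?R \<longlongrightarrow> 0) (at x)"
    proof (rule Lim_null_comparison[rotated], intro always_eventually allI)
      fix y
      have "\<bar>Z y \<bullet> X y\<bar> / (norm (Z y))\<^sup>2 * norm (Z y) \<le> norm (X y)"
        using Cauchy_Schwarz_ineq2[of "Z y" "X y"]
        by (cases "Z y = 0") (auto simp: field_simps power2_eq_square)
      then have "\<bar>m y\<bar> * (\<bar>Z y \<bullet> X y\<bar> / (norm (Z y))\<^sup>2 * norm (Z y)) \<le> \<bar>m y\<bar> * norm (X y)"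
        by (intro mult_left_mono) auto
      then show "norm (?R y) \<le> \<bar>m y\<bar> * norm (X y)"
        by (simp add: abs_mult)
    qed
    then show ?thesis using True by (simp add: continuous_at)
  qed
  then have "continuous_on UNIV ?R"
    by (simp add: continuous_at_imp_continuous_on)
  from continuous_on_add[OF continuous_on_scaleR[OF continuous_k_norm[OF Z] X] this]
  show ?thesis
    unfolding H_def m_def .
qed

lemma G_has_derivative: "(G has_derivative H Z) (at Z)"
proof (cases "Z = 0")
  case True
  have "((\<lambda>Y::'a. k (norm Y)) \<longlongrightarrow> k (norm (0::'a))) (at 0)"
    using continuous_k_norm[of UNIV "\<lambda>Y::'a. Y", OF continuous_on_id] unfolding continuous_on_def by blast
  then have "((\<lambda>Y::'a. \<bar>k (norm Y) - k 0\<bar>) \<longlongrightarrow> \<bar>k 0 - k 0\<bar>) (at (0::'a))"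
    by (intro tendsto_intros) simp
  then have "((\<lambda>Y. \<bar>k (norm Y) - k 0\<bar>) \<longlongrightarrow> 0) (at (0::'a))"
    by simp
  then have "((\<lambda>Y. norm (G (0 + Y) - G 0 - k 0 *\<^sub>R Y) / norm Y) \<longlongrightarrow> 0) (at (0::'a))"
    by (rule Lim_transform_eventually)
       (auto simp: eventually_at_filter G_def simp flip: scaleR_diff_left)
  then have "(G has_derivative (\<lambda>X. k 0 *\<^sub>R X)) (at (0::'a))"
    unfolding has_derivative_at by (simp add: bounded_linear_scaleR_right)
  moreover have "H (0::'a) = (\<lambda>X. k 0 *\<^sub>R X)"
    by (simp add: H_def fun_eq_iff)
  ultimately show ?thesis using True by simp
next
  case False
  let ?t = "norm Z"
  have t: "?t > 0" using False by simp
  have "((\<lambda>t. g1 t / t) has_real_derivative (g2 ?t * ?t - g1 ?t) / (?t * ?t)) (at ?t)"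
    using t by (auto intro!: derivative_eq_intros g1_deriv_at)
  then have "((\<lambda>Y. g1 (norm Y) / norm Y) has_derivative (\<lambda>X. (X \<bullet> sgn Z) * ((g2 ?t * ?t - g1 ?t) / (?t * ?t)))) (at Z)"
    by (rule DERIV_compose_FDERIV) (rule has_derivative_norm[OF False])
  from has_derivative_scaleR[OF this has_derivative_ident]
  have "((\<lambda>Y. (g1 (norm Y) / norm Y) *\<^sub>R Y) has_derivative
     (\<lambda>X. (g1 ?t / ?t) *\<^sub>R X + ((X \<bullet> sgn Z) * ((g2 ?t * ?t - g1 ?t) / (?t * ?t))) *\<^sub>R Z)) (at Z)" .
  also have "(\<lambda>X. (g1 ?t / ?t) *\<^sub>R X + ((X \<bullet> sgn Z) * ((g2 ?t * ?t - g1 ?t) / (?t * ?t))) *\<^sub>R Z) = H Z"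
  proof
    fix X
    have "(X \<bullet> sgn Z) * ((g2 ?t * ?t - g1 ?t) / (?t * ?t)) = (g2 ?t - g1 ?t / ?t) * (Z \<bullet> X) / ?t\<^sup>2"
      using t by (simp add: sgn_div_norm inner_commute field_simps power2_eq_square)
    then show "(g1 ?t / ?t) *\<^sub>R X + ((X \<bullet> sgn Z) * ((g2 ?t * ?t - g1 ?t) / (?t * ?t))) *\<^sub>R Z = H Z X"
      using False by (simp add: H_def k_def)
  qed
  finally have "((\<lambda>Y. (g1 (norm Y) / norm Y) *\<^sub>R Y) has_derivative H Z) (at Z)" .
  then show ?thesis
    by (rule has_derivative_transform_within_open[where s = "- {0}"])
       (use False in \<open>auto simp: G_def k_def\<close>)
qed

lemma grad_radial:
  fixes F :: "'a::euclidean_space \<Rightarrow> real"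
  assumes g: "\<And>t. t \<ge> 0 \<Longrightarrow> (g has_real_derivative g1 t) (at t within {0..})"
    and F: "\<And>Z. F Z = g (norm Z)"
  shows "grad F Z = G Z"
proof (rule grad_eqI, cases "Z = 0")
  case True
  have "((\<lambda>t. \<bar>(g t - g 0) / (t - 0)\<bar>) \<longlongrightarrow> \<bar>g1 0\<bar>) (at 0 within {0..})"
    using g[of 0] by (intro tendsto_rabs) (simp add: has_field_derivative_iff)
  then have lim: "((\<lambda>t. \<bar>(g t - g 0) / (t - 0)\<bar>) \<longlongrightarrow> 0) (at 0 within {0..})"
    by (simp add: g1_0)
  have nrm: "filterlim (norm :: 'a \<Rightarrow> real) (at 0 within {0..}) (at 0)"
    unfolding filterlim_at
    by (auto simp: eventually_at_filter intro!: tendsto_norm_zero)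
  have "((\<lambda>Y::'a. \<bar>(g (norm Y) - g 0) / (norm Y - 0)\<bar>) \<longlongrightarrow> 0) (at 0)"
    by (rule filterlim_compose[OF lim nrm])
  then have "((\<lambda>Y::'a. norm (F (0 + Y) - F 0 - 0) / norm Y) \<longlongrightarrow> 0) (at 0)"
    by (simp add: F abs_divide)
  then have "(F has_derivative (\<lambda>h. 0)) (at 0)"
    unfolding has_derivative_at by (simp add: bounded_linear_zero)
  then show "GDERIV F Z :> G Z"
    using True by (simp add: gderiv_def G_def)
next
  case False
  then have "(g has_real_derivative g1 (norm Z)) (at (norm Z))"
    using g[of "norm Z"] at_within_interior[of "norm Z" "{0..}"] by (simp add: interior_Ici[of "-1"])
  then have "GDERIV (\<lambda>Z. g (norm Z)) Z :> g1 (norm Z) *\<^sub>R sgn Z"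
    by (rule GDERIV_DERIV_compose[OF GDERIV_norm[OF False]])
  moreover have "g1 (norm Z) *\<^sub>R sgn Z = G Z"
    using False by (simp add: G_def k_def sgn_div_norm divide_inverse_commute mult.commute)
  ultimately show "GDERIV F Z :> G Z"
    by (simp add: F[abs_def])
qed

end

section \<open>A cut-off function\<close>

text \<open>A \<open>C\<^sup>1\<close> function on the line that is \<open>1\<close> on \<open>s \<le> 1\<close> and \<open>0\<close> on \<open>s \<ge> 2\<close>, and its
  derivative.\<close>

definition cut :: "real \<Rightarrow> real" where
  "cut s = (max 0 (1 - (max 0 (s - 1))\<^sup>2))\<^sup>2"

definition cut' :: "real \<Rightarrow> real" where
  "cut' s = - 4 * max 0 (1 - (max 0 (s - 1))\<^sup>2) * max 0 (s - 1)"

lemma max_0_square_deriv: "((\<lambda>x::real. (max 0 x)\<^sup>2) has_real_derivative 2 * max 0 x) (at x)"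
proof -
  consider "x < 0" | "x > 0" | "x = 0" by linarith
  then show ?thesis
  proof cases
    case 1
    have "((\<lambda>x::real. 0) has_real_derivative 2 * max 0 x) (at x)"
      using 1 by (auto intro!: derivative_eq_intros)
    then show ?thesis
      by (rule has_field_derivative_transform_within_open[where S = "{..<0}"]) (use 1 in auto)
  next
    case 2
    have "((\<lambda>x::real. x\<^sup>2) has_real_derivative 2 * max 0 x) (at x)"
      using 2 by (auto intro!: derivative_eq_intros)
    then show ?thesis
      by (rule has_field_derivative_transform_within_open[where S = "{0<..}"]) (use 2 in auto)
  next
    case 3
    have "((\<lambda>h::real. (max 0 h)\<^sup>2 / h) \<longlongrightarrow> 0) (at 0)"
    proof (rule Lim_null_comparison, rule always_eventually, rule allI)
      fix h :: real show "norm ((max 0 h)\<^sup>2 / h) \<le> \<bar>h\<bar>"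
        by (auto simp: max_def power2_eq_square)
      show "((\<lambda>h::real. \<bar>h\<bar>) \<longlongrightarrow> 0) (at 0)"
        by (intro tendsto_rabs_zero tendsto_ident_at)
    qed
    then show ?thesis
      using 3 by (simp add: DERIV_def)
  qed
qed

lemma cut_deriv: "(cut has_real_derivative cut' s) (at s)"
proof -
  have "((\<lambda>s. 1 - (max 0 (s - 1))\<^sup>2) has_real_derivative 0 - 2 * max 0 (s - 1) * (1 - 0)) (at s)"
    by (intro DERIV_diff DERIV_const DERIV_chain2[OF max_0_square_deriv] DERIV_ident)
  from DERIV_chain2[OF max_0_square_deriv this] show ?thesis
    by (simp add: cut_def[abs_def] cut'_def mult.assoc mult.left_commute)
qed

lemma cut'_cont: "continuous_on S cut'"
  unfolding cut'_def by (intro continuous_intros)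

lemma cut_bounds: "0 \<le> cut s" "cut s \<le> 1"
proof -
  show "0 \<le> cut s" by (simp add: cut_def)
  have "max 0 (1 - (max 0 (s - 1))\<^sup>2) \<le> 1" by simp
  then show "cut s \<le> 1" unfolding cut_def by (intro power_le_one) auto
qed

lemma cut_eq_1: "s \<le> 1 \<Longrightarrow> cut s = 1"
  by (simp add: cut_def)

lemma cut_eq_0: "s \<ge> 2 \<Longrightarrow> cut s = 0"
proof -
  assume "s \<ge> 2"
  then have "1\<^sup>2 \<le> (max 0 (s - 1))\<^sup>2" by (intro power_mono) auto
  then show ?thesis by (simp add: cut_def)
qed

lemma cut'_eq_0: "s \<le> 1 \<or> s \<ge> 2 \<Longrightarrow> cut' s = 0"
proof (elim disjE)
  assume "s \<ge> 2"
  then have "1\<^sup>2 \<le> (max 0 (s - 1))\<^sup>2" by (intro power_mono) auto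
  then show ?thesis by (simp add: cut'_def)
qed (simp add: cut'_def)

lemma cut'_le: "\<bar>cut' s\<bar> \<le> 4"
proof (cases "s \<le> 1 \<or> s \<ge> 2")
  case False
  have "max 0 (1 - (max 0 (s - 1))\<^sup>2) * max 0 (s - 1) \<le> 1 * 1"
    using False by (intro mult_mono) auto
  then show ?thesis by (simp add: cut'_def abs_mult)
qed (simp add: cut'_eq_0)

text \<open>The cut-off with respect to the distance from the origin: it is \<open>1\<close> on the ball of radius \<open>S\<close>
  and vanishes outside the ball of radius \<open>2 S\<close>.\<close>

definition ball_cut :: "real \<Rightarrow> 'a::euclidean_space \<Rightarrow> real" where
  "ball_cut S x = cut ((norm x)\<^sup>2 / S\<^sup>2)"

lemma C1_grad_norm_square: "C1_grad (\<lambda>x::'a::euclidean_space. (norm x)\<^sup>2) (\<lambda>x. 2 *\<^sub>R x)"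
proof -
  have "GDERIV (\<lambda>x::'a. (norm x)\<^sup>2) x :> 2 *\<^sub>R x" for x
    unfolding gderiv_def power2_norm_eq_inner
    by (auto intro!: derivative_eq_intros simp: inner_commute)
  then show ?thesis
    by (simp add: C1_grad_def continuous_intros)
qed

lemma C1_grad_cut_scaled:
  assumes "C1_grad f f'"
  shows "C1_grad (\<lambda>x. cut (f x / R)) (\<lambda>x. (cut' (f x / R) / R) *\<^sub>R f' x)"
proof -
  have "((\<lambda>s. cut (s / R)) has_real_derivative cut' (s / R) / R) (at s)" for s
    using DERIV_chain2[OF cut_deriv DERIV_cdivide[OF DERIV_ident], where x = s and s = UNIV and c1 = R] by simp
  then show ?thesis
    by (rule C1_grad_compose[OF assms])
       (unfold divide_inverse, intro continuous_intros continuous_on_compose2[OF cut'_cont], auto)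
qed

lemma C1_grad_ball_cut:
  "C1_grad (ball_cut S :: 'a::euclidean_space \<Rightarrow> real) (\<lambda>x. (cut' ((norm x)\<^sup>2 / S\<^sup>2) / S\<^sup>2) *\<^sub>R (2 *\<^sub>R x))"
  unfolding ball_cut_def[abs_def] by (rule C1_grad_cut_scaled[OF C1_grad_norm_square])

lemma ball_cut_bounds: "0 \<le> ball_cut S x" "ball_cut S x \<le> 1"
  by (simp_all add: ball_cut_def cut_bounds)

lemma ball_cut_eq_1: "S > 0 \<Longrightarrow> norm x \<le> S \<Longrightarrow> ball_cut S x = 1"
  unfolding ball_cut_def by (intro cut_eq_1) (simp add: power_mono)

lemma ball_cut_eq_0:
  assumes "S > 0" "norm x > 2 * S"
  shows "ball_cut S x = 0"
proof -
  have "2 * S\<^sup>2 \<le> (2 * S)\<^sup>2" by (simp add: power_mult_distrib)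
  also have "\<dots> \<le> (norm x)\<^sup>2" using assms by (intro power_mono) auto
  finally show ?thesis
    using assms unfolding ball_cut_def by (intro cut_eq_0) (simp add: field_simps)
qed

lemma integrable_ball_cut: "S > 0 \<Longrightarrow> integrable lborel (ball_cut S :: 'a::euclidean_space \<Rightarrow> real)"
  by (rule integrable_compact_support[OF C1_grad_continuous[OF C1_grad_ball_cut]]) (rule ball_cut_eq_0)

lemma integral_ball_cut_le:
  assumes "S > 0" "DIM('a::euclidean_space) = 2"
  shows "(\<integral>x. ball_cut S (x::'a) \<partial>lborel) \<le> 4 * pi * S\<^sup>2"
proof -
  have "(\<integral>x. ball_cut S (x::'a) \<partial>lborel) \<le> (\<integral>x. indicator (cball (0::'a) (2 * S)) x \<partial>lborel)"
  proof (rule integral_mono)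
    show "integrable lborel (indicator (cball (0::'a) (2 * S)) :: 'a \<Rightarrow> real)"
      by (intro integrable_real_indicator emeasure_lborel_cball_finite) auto
    show "ball_cut S x \<le> indicator (cball (0::'a) (2 * S)) x" for x :: 'a
      using ball_cut_bounds(2)[of S x] ball_cut_eq_0[OF assms(1), of x]
      by (auto simp: indicator_def)
  qed (rule integrable_ball_cut[OF assms(1)])
  also have "\<dots> = measure lborel (cball (0::'a) (2 * S))"
    by simp
  also have "\<dots> = 4 * pi * S\<^sup>2"
    using assms by (simp add: content_cball unit_ball_vol_2 power_mult_distrib)
  finally show ?thesis .
qed

section \<open>Entire solutions in the plane\<close>

text \<open>\<open>Z\<close> is the gradient of \<open>u\<close> and \<open>D x\<close> its Hessian at \<open>x\<close>. The equation is stated as the vanishing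
  of the trace of \<open>h \<mapsto> H (Z x) (D x h)\<close>, the derivative of the flux \<open>G (Z x)\<close>.\<close>

locale entire_solution = radial_integrand g1 g2 c
  for g1 g2 :: "real \<Rightarrow> real" and c :: real +
  fixes u :: "'a::euclidean_space \<Rightarrow> real" and Z :: "'a \<Rightarrow> 'a" and D :: "'a \<Rightarrow> 'a \<Rightarrow> 'a"
  assumes u: "C1_grad u Z" and Z: "C1_field Z D"
    and equation: "\<And>x. (\<Sum>b\<in>Basis. H (Z x) (D x b) \<bullet> b) = 0"
    and dim: "DIM('a) = 2"
begin

lemma u_cont: "continuous_on S u"
  using C1_grad_continuous[OF u] continuous_on_subset by blast

lemma Z_cont: "continuous_on S Z"
  using C1_field_continuous[OF Z] continuous_on_subset by blast

lemma D_cont: "continuous_on S (\<lambda>x. D x h)"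
  using Z continuous_on_subset unfolding C1_field_def by blast

lemma C1_field_flux: "C1_field (\<lambda>x. G (Z x)) (\<lambda>x h. H (Z x) (D x h))"
proof -
  have "((\<lambda>x. G (Z x)) has_derivative (\<lambda>h. H (Z x) (D x h))) (at x)" for x
    by (rule has_derivative_compose[OF _ G_has_derivative]) (use Z in \<open>simp add: C1_field_def\<close>)
  moreover have "continuous_on UNIV (\<lambda>x. H (Z x) (D x h))" for h
    by (intro continuous_H Z_cont D_cont)
  ultimately show ?thesis by (simp add: C1_field_def)
qed

lemma flux_cont: "continuous_on UNIV (\<lambda>x. G (Z x))"
  by (rule C1_field_continuous[OF C1_field_flux])

text \<open>The cut-off \<open>\<eta> R\<close> is taken with respect to the distance of the point \<open>(x, u x)\<close> of the graph
  from the origin of the three-dimensional space, whose square is \<open>\<rho>\<close>.\<close>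

definition \<rho> :: "'a \<Rightarrow> real" where
  "\<rho> x = (norm x)\<^sup>2 + (u x)\<^sup>2"

definition \<eta> :: "real \<Rightarrow> 'a \<Rightarrow> real" where
  "\<eta> R x = cut (\<rho> x / R\<^sup>2)"

text \<open>The gradient field of \<open>\<eta> R\<close>.\<close>

definition \<eta>' :: "real \<Rightarrow> 'a \<Rightarrow> 'a" where
  "\<eta>' R x = (cut' (\<rho> x / R\<^sup>2) / R\<^sup>2) *\<^sub>R (2 *\<^sub>R (x + u x *\<^sub>R Z x))"

lemma C1_grad_\<eta>: "C1_grad (\<eta> R) (\<eta>' R)"
proof -
  have "C1_grad \<rho> (\<lambda>x. 2 *\<^sub>R (x + u x *\<^sub>R Z x))"
  proof -
    have "GDERIV \<rho> x :> 2 *\<^sub>R x + (u x *\<^sub>R Z x + u x *\<^sub>R Z x)" for x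
      unfolding \<rho>_def[abs_def] power2_eq_square[of "u _"]
      using C1_grad_norm_square[where 'a = 'a] u
      by (intro GDERIV_add GDERIV_mult) (simp_all add: C1_grad_def)
    moreover have "2 *\<^sub>R x + (u x *\<^sub>R Z x + u x *\<^sub>R Z x) = 2 *\<^sub>R (x + u x *\<^sub>R Z x)" for x
      by (simp only: scaleR_add_right scaleR_2)
    ultimately show ?thesis
      by (auto simp: C1_grad_def intro!: continuous_intros u_cont Z_cont)
  qed
  then show ?thesis
    unfolding \<eta>_def[abs_def] \<eta>'_def[abs_def] by (rule C1_grad_cut_scaled)
qed

lemma \<eta>_cont: "continuous_on UNIV (\<eta> R)"
  by (rule C1_grad_continuous[OF C1_grad_\<eta>])

lemma \<eta>'_cont: "continuous_on UNIV (\<eta>' R)"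
  using C1_grad_\<eta> by (simp add: C1_grad_def)

lemma \<eta>_bounds: "0 \<le> \<eta> R x" "\<eta> R x \<le> 1"
  by (simp_all add: \<eta>_def cut_bounds)

lemma \<eta>_eq_1: "R > 0 \<Longrightarrow> \<rho> x \<le> R\<^sup>2 \<Longrightarrow> \<eta> R x = 1"
  unfolding \<eta>_def by (intro cut_eq_1) (simp add: field_simps)

lemma \<eta>_eq_0: "R > 0 \<Longrightarrow> \<rho> x \<ge> 2 * R\<^sup>2 \<Longrightarrow> \<eta> R x = 0"
  unfolding \<eta>_def by (intro cut_eq_0) (simp add: field_simps)

lemma \<eta>'_eq_0: "R > 0 \<Longrightarrow> \<rho> x \<le> R\<^sup>2 \<or> \<rho> x \<ge> 2 * R\<^sup>2 \<Longrightarrow> \<eta>' R x = 0"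
  unfolding \<eta>'_def by (subst cut'_eq_0) (auto simp: field_simps)

lemma \<eta>_support:
  assumes "R > 0" "norm x > 2 * R"
  shows "\<eta> R x = 0"
proof (rule \<eta>_eq_0[OF assms(1)])
  have "2 * R\<^sup>2 \<le> (2 * R)\<^sup>2" by (simp add: power_mult_distrib)
  also have "\<dots> \<le> (norm x)\<^sup>2" using assms by (intro power_mono) auto
  finally show "2 * R\<^sup>2 \<le> \<rho> x" by (simp add: \<rho>_def add_increasing2)
qed

text \<open>The equation is tested with \<open>ball_cut S\<close> times \<open>S arctan (u / S)\<close>. The truncation of \<open>u\<close> is of size
  \<open>S\<close>, the gradient of the cut-off is of size \<open>1 / S\<close>, and the flux is bounded by \<open>c\<close>.\<close>

lemma flux_area:
  assumes S: "S > 0"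
  shows "(\<integral>x. ball_cut S x * (1 / (1 + (u x / S)\<^sup>2)) * (g1 (norm (Z x)) * norm (Z x)) \<partial>lborel)
    \<le> 512 * c * pi * S\<^sup>2" (is "(\<integral>x. ?L x \<partial>lborel) \<le> _")
proof -
  let ?h' = "\<lambda>s. 1 / (1 + (s / S)\<^sup>2)"
  let ?h = "\<lambda>s. S * arctan (s / S)"
  let ?q = "\<lambda>x. (cut' ((norm x)\<^sup>2 / S\<^sup>2) / S\<^sup>2) *\<^sub>R (2 *\<^sub>R x)"
  have nz: "1 + (s / S)\<^sup>2 \<noteq> 0" for s
    by (smt (verit) zero_le_power2)
  have "(?h has_real_derivative S * (inverse (1 + (s / S)\<^sup>2) * (1 / S))) (at s)" for s
    by (intro DERIV_cmult DERIV_chain2[OF DERIV_arctan] DERIV_cdivide DERIV_ident)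
  then have "(?h has_real_derivative ?h' s) (at s)" for s
    using S by (simp add: inverse_eq_divide)
  moreover have conth': "continuous_on UNIV ?h'"
    using nz S by (intro continuous_intros) auto
  ultimately have Ch: "C1_grad (\<lambda>x. ?h (u x)) (\<lambda>x. ?h' (u x) *\<^sub>R Z x)"
    by (rule C1_grad_compose[OF u])
  have "(\<integral>x. G (Z x) \<bullet> (ball_cut S x *\<^sub>R (?h' (u x) *\<^sub>R Z x) + ?h (u x) *\<^sub>R ?q x) \<partial>lborel) = 0"
    by (rule integral_divergence_free[OF C1_field_flux equation C1_grad_mult[OF C1_grad_ball_cut Ch], where R = "2 * S"])
       (simp add: ball_cut_eq_0[OF S])
  also have "(\<lambda>x. G (Z x) \<bullet> (ball_cut S x *\<^sub>R (?h' (u x) *\<^sub>R Z x) + ?h (u x) *\<^sub>R ?q x))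
     = (\<lambda>x. ?L x + ?h (u x) * (G (Z x) \<bullet> ?q x))"
    by (rule ext) (simp add: inner_add_right G_inner)
  finally have int0: "(\<integral>x. ?L x + ?h (u x) * (G (Z x) \<bullet> ?q x) \<partial>lborel) = 0" .
  have bound: "- (?h (u x) * (G (Z x) \<bullet> ?q x)) \<le> 32 * c * ball_cut (2 * S) x" for x
  proof (cases "norm x \<le> 2 * S")
    case False
    then have "(norm x)\<^sup>2 \<ge> (2 * S)\<^sup>2" using S by (intro power_mono) auto
    moreover have "2 * S\<^sup>2 \<le> (2 * S)\<^sup>2" by (simp add: power_mult_distrib)
    ultimately have "(norm x)\<^sup>2 \<ge> 2 * S\<^sup>2" by (rule order_trans[rotated])
    then have "(norm x)\<^sup>2 / S\<^sup>2 \<ge> 2" using S by (simp add: field_simps)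
    then show ?thesis
      using c_pos ball_cut_bounds(1)[of "2 * S" x] by (simp add: cut'_eq_0)
  next
    case True
    have h: "\<bar>?h (u x)\<bar> \<le> S * 2"
      unfolding abs_mult using S arctan_bounded[of "u x / S"] pi_less_4
      by (intro mult_mono) auto
    have "norm (?q x) = \<bar>cut' ((norm x)\<^sup>2 / S\<^sup>2)\<bar> / S\<^sup>2 * (2 * norm x)"
      unfolding norm_scaleR by simp
    also have "\<dots> \<le> 4 / S\<^sup>2 * (2 * (2 * S))"
      using True S by (intro mult_mono divide_right_mono cut'_le) auto
    also have "\<dots> = 16 / S" using S by (simp add: power2_eq_square)
    finally have q: "norm (?q x) \<le> 16 / S" .
    have "\<bar>?h (u x) * (G (Z x) \<bullet> ?q x)\<bar> \<le> (S * 2) * (c * (16 / S))"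
      unfolding abs_mult[of "?h (u x)"]
      using S h c_pos
      by (intro mult_mono order_trans[OF Cauchy_Schwarz_ineq2 mult_mono[OF norm_G q]]) auto
    also have "\<dots> = 32 * c" using S by simp
    finally have "- (?h (u x) * (G (Z x) \<bullet> ?q x)) \<le> 32 * c"
      by (rule abs_le_D2)
    moreover have "ball_cut (2 * S) x = 1"
      using True S by (intro ball_cut_eq_1) auto
    ultimately show ?thesis by (simp only: mult_1_right)
  qed
  have "continuous_on UNIV (?q :: 'a \<Rightarrow> 'a)"
    using C1_grad_ball_cut[of S, where 'a = 'a] unfolding C1_grad_def by blast
  then have contG: "continuous_on UNIV (\<lambda>x. G (Z x) \<bullet> ?q x)"
    by (rule continuous_on_inner[OF flux_cont])
  have contE: "continuous_on UNIV (\<lambda>x. ?h (u x) * (G (Z x) \<bullet> ?q x))"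
    by (rule continuous_on_mult[OF C1_grad_continuous[OF Ch] contG])
  have contL: "continuous_on UNIV ?L"
    using nz S by (intro continuous_intros C1_grad_continuous[OF C1_grad_ball_cut] u_cont
        continuous_g1_norm Z_cont) auto
  have "(\<integral>x. ?L x \<partial>lborel) = (\<integral>x. ?L x \<partial>lborel) - (\<integral>x. ?L x + ?h (u x) * (G (Z x) \<bullet> ?q x) \<partial>lborel)"
    using int0 by simp
  also have "\<dots> = (\<integral>x. ?L x - (?L x + ?h (u x) * (G (Z x) \<bullet> ?q x)) \<partial>lborel)"
  proof (rule Bochner_Integration.integral_diff[symmetric])
    show "integrable lborel ?L"
      by (rule integrable_compact_support[OF contL, where R = "2 * S"]) (simp add: ball_cut_eq_0[OF S])
    show "integrable lborel (\<lambda>x. ?L x + ?h (u x) * (G (Z x) \<bullet> ?q x))"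
    proof (rule integrable_compact_support[where R = "2 * S"])
      show "continuous_on UNIV (\<lambda>x. ?L x + ?h (u x) * (G (Z x) \<bullet> ?q x))"
        by (intro continuous_on_add contL contE)
      show "?L x + ?h (u x) * (G (Z x) \<bullet> ?q x) = 0" if "norm x > 2 * S" for x
        using C1_grad_zero_outside[OF C1_grad_ball_cut ball_cut_eq_0[OF S] that] ball_cut_eq_0[OF S that]
        by auto
    qed
  qed
  also have "\<dots> \<le> (\<integral>x. 32 * c * ball_cut (2 * S) (x::'a) \<partial>lborel)"
  proof (rule integral_mono)
    show "integrable lborel (\<lambda>x::'a. 32 * c * ball_cut (2 * S) x)"
      using S by (intro integrable_mult_right integrable_ball_cut) simp
    show "?L x - (?L x + ?h (u x) * (G (Z x) \<bullet> ?q x)) \<le> 32 * c * ball_cut (2 * S) x" for x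
      using bound[of x] by linarith
    show "integrable lborel (\<lambda>x. ?L x - (?L x + ?h (u x) * (G (Z x) \<bullet> ?q x)))"
    proof (rule integrable_compact_support[where R = "2 * S"])
      show "continuous_on UNIV (\<lambda>x. ?L x - (?L x + ?h (u x) * (G (Z x) \<bullet> ?q x)))"
        by (intro continuous_on_diff continuous_on_add contL contE)
      show "?L x - (?L x + ?h (u x) * (G (Z x) \<bullet> ?q x)) = 0" if "norm x > 2 * S" for x
        using C1_grad_zero_outside[OF C1_grad_ball_cut ball_cut_eq_0[OF S] that] ball_cut_eq_0[OF S that]
        by auto
    qed
  qed
  also have "\<dots> = 32 * c * (\<integral>x. ball_cut (2 * S) (x::'a) \<partial>lborel)"
    by simp
  also have "\<dots> \<le> 32 * c * (4 * pi * (2 * S)\<^sup>2)"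
    using c_pos S dim by (intro mult_left_mono integral_ball_cut_le) auto
  finally show ?thesis by (simp add: power_mult_distrib)
qed

text \<open>The area of the graph in a ball of radius \<open>R\<close> in space grows at most quadratically.\<close>

lemma area_growth:
  obtains C where "C > 0" "\<And>R. R > 0 \<Longrightarrow> (\<integral>x. \<eta> R x * (1 + norm (Z x)) \<partial>lborel) \<le> C * R\<^sup>2"
proof
  have g1: "g1 1 > 0" by (rule g1_pos) simp
  let ?C = "32 * pi + 2 / g1 1 * (2048 * c * pi)"
  show "?C > 0"
    using g1 c_pos by (intro add_pos_pos mult_pos_pos) auto
  fix R :: real assume R: "R > 0"
  let ?S = "2 * R"
  let ?w = "\<lambda>x. 1 / (1 + (u x / ?S)\<^sup>2)"
  let ?L = "\<lambda>x. ball_cut ?S x * ?w x * (g1 (norm (Z x)) * norm (Z x))"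
  have nz: "1 + (s / ?S)\<^sup>2 \<noteq> 0" for s
    by (smt (verit) zero_le_power2)
  have S: "?S > 0" using R by simp
  have Lnn: "?L x \<ge> 0" for x
  proof -
    have g: "0 \<le> g1 (norm (Z x)) * norm (Z x)"
      using g1_pos[of "norm (Z x)"] by (cases "Z x = 0") auto
    have w: "0 \<le> ?w x" by (simp add: add_nonneg_nonneg)
    show ?thesis by (rule mult_nonneg_nonneg[OF mult_nonneg_nonneg[OF ball_cut_bounds(1) w] g])
  qed
  have contL: "continuous_on UNIV ?L"
    using nz S by (intro continuous_intros C1_grad_continuous[OF C1_grad_ball_cut] u_cont
        continuous_g1_norm Z_cont) auto
  have intL: "integrable lborel ?L"
    by (rule integrable_compact_support[OF contL, where R = "2 * ?S"]) (simp add: ball_cut_eq_0[OF S])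
  have "(\<integral>x. \<eta> R x * (1 + norm (Z x)) \<partial>lborel) \<le> (\<integral>x. 2 * ball_cut ?S x + 2 / g1 1 * ?L x \<partial>lborel)"
  proof (rule integral_mono)
    show "integrable lborel (\<lambda>x. \<eta> R x * (1 + norm (Z x)))"
      by (rule integrable_compact_support[where R = "2 * R"])
         (auto intro!: continuous_intros \<eta>_cont Z_cont simp: \<eta>_support[OF R])
    show "integrable lborel (\<lambda>x. 2 * ball_cut ?S x + 2 / g1 1 * ?L x)"
      by (intro Bochner_Integration.integrable_add integrable_mult_right integrable_ball_cut[OF S] intL)
    fix x
    show "\<eta> R x * (1 + norm (Z x)) \<le> 2 * ball_cut ?S x + 2 / g1 1 * ?L x"
    proof (cases "\<rho> x \<ge> 2 * R\<^sup>2")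
      case True
      have "0 \<le> 2 / g1 1 * ?L x"
        using g1 by (intro mult_nonneg_nonneg[OF _ Lnn]) simp
      moreover have "0 \<le> 2 * ball_cut ?S x"
        by (intro mult_nonneg_nonneg ball_cut_bounds(1)) simp
      ultimately have "0 \<le> 2 * ball_cut ?S x + 2 / g1 1 * ?L x"
        by (rule add_nonneg_nonneg[rotated])
      moreover have "\<eta> R x * (1 + norm (Z x)) = 0"
        using \<eta>_eq_0[OF R True] by simp
      ultimately show ?thesis by (simp only:)
    next
      case False
      \<comment> \<open>Here \<open>\<bar>x\<bar>\<close> and \<open>\<bar>u\<bar>\<close> are at most \<open>S = 2 R\<close>, so the cut-off is \<open>1\<close> and the derivative of
        the truncation is at least \<open>1 / 2\<close>.\<close>
      have "(norm x)\<^sup>2 \<le> 4 * R\<^sup>2" "(u x)\<^sup>2 \<le> 4 * R\<^sup>2"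
        using False zero_le_power2[of "norm x"] zero_le_power2[of "u x"] zero_le_power2[of R]
        unfolding \<rho>_def by linarith+
      then have le: "(norm x)\<^sup>2 \<le> ?S\<^sup>2" "(u x)\<^sup>2 \<le> ?S\<^sup>2"
        by (simp_all add: power_mult_distrib)
      have b1: "ball_cut ?S x = 1"
        using power2_le_imp_le[OF le(1)] S by (intro ball_cut_eq_1) auto
      have u1: "(u x / ?S)\<^sup>2 \<le> 1"
        using le(2) S unfolding power_divide by (simp only: divide_le_eq_1_pos zero_less_power)
      have w: "1 / 2 \<le> ?w x"
      proof (rule divide_left_mono)
        show "1 + (u x / ?S)\<^sup>2 \<le> 2" using u1 by linarith
        show "0 < 2 * (1 + (u x / ?S)\<^sup>2)"
          by (intro mult_pos_pos add_pos_nonneg) auto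
      qed simp
      let ?t = "norm (Z x)"
      define X where "X = 2 / g1 1 * ?L x"
      \<comment> \<open>Since \<open>g'\<close> is increasing, \<open>t\<close> is controlled by \<open>g'(t) t\<close> for \<open>t \<ge> 1\<close>.\<close>
      have t1: "?t \<le> 1 + ?t * g1 ?t / g1 1"
      proof (cases "?t \<le> 1")
        case True
        have "0 \<le> ?t * g1 ?t / g1 1"
          using g1 g1_pos[of ?t] g1_0 by (cases "Z x = 0") auto
        then show ?thesis using True by linarith
      next
        case False
        then have "g1 1 \<le> g1 ?t" using g1_less[of 1 ?t] by simp
        then have "?t * g1 1 \<le> ?t * g1 ?t" by (intro mult_left_mono) auto
        then have "?t \<le> ?t * g1 ?t / g1 1" using g1 by (simp add: field_simps)
        then show ?thesis by simp
      qed
      have t2: "?t * g1 ?t / g1 1 \<le> X"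
      proof -
        have "0 \<le> g1 ?t * ?t"
          using g1_pos[of ?t] by (cases "Z x = 0") auto
        then have "(1 / 2) * (g1 ?t * ?t) \<le> ?w x * (g1 ?t * ?t)"
          by (intro mult_right_mono w)
        then have "2 / g1 1 * ((1 / 2) * (g1 ?t * ?t)) \<le> 2 / g1 1 * (?w x * (g1 ?t * ?t))"
          using g1 by (intro mult_left_mono) auto
        then show ?thesis unfolding X_def b1 by (simp add: mult.commute)
      qed
      have "\<eta> R x * (1 + ?t) \<le> 1 * (1 + ?t)"
        by (intro mult_right_mono \<eta>_bounds) auto
      also have "\<dots> \<le> 1 + (1 + X)"
        using order_trans[OF t1 add_left_mono[OF t2]] by simp
      finally have "\<eta> R x * (1 + ?t) \<le> 2 * 1 + X" by simp
      then show ?thesis unfolding X_def b1 .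
    qed
  qed
  also have "\<dots> = 2 * (\<integral>x. ball_cut ?S (x::'a) \<partial>lborel) + 2 / g1 1 * (\<integral>x. ?L x \<partial>lborel)"
    by (simp only: Bochner_Integration.integral_add[OF integrable_mult_right[OF integrable_ball_cut[OF S]]
          integrable_mult_right[OF intL]] integral_mult_right_zero)
  also have "\<dots> \<le> 2 * (4 * pi * ?S\<^sup>2) + 2 / g1 1 * (512 * c * pi * ?S\<^sup>2)"
    using g1 dim by (intro add_mono mult_left_mono integral_ball_cut_le flux_area S) auto
  also have "\<dots> = ?C * R\<^sup>2"
    by (simp add: power_mult_distrib algebra_simps)
  finally show "(\<integral>x. \<eta> R x * (1 + norm (Z x)) \<partial>lborel) \<le> ?C * R\<^sup>2" .
qed

section \<open>The weighted Dirichlet integral of a partial derivative\<close>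

text \<open>\<open>Q e\<close> is the density that comes from testing the equation for \<open>\<partial>\<^sub>e u\<close> with its arctangent.\<close>

definition Q :: "'a \<Rightarrow> 'a \<Rightarrow> real" where
  "Q e x = 1 / (1 + (Z x \<bullet> e)\<^sup>2) * (H (Z x) (D x e) \<bullet> D x e)"

lemma one_plus_square_pos: "0 < 1 + (s::real)\<^sup>2"
  by (simp add: add_pos_nonneg)

lemma Q_nonneg: "0 \<le> Q e x"
  unfolding Q_def by (intro mult_nonneg_nonneg H_nonneg) (simp add: add_nonneg_nonneg)

lemma Q_cont: "continuous_on UNIV (Q e)"
  unfolding Q_def using one_plus_square_pos
  by (intro continuous_intros continuous_H Z_cont D_cont) (auto simp: less_imp_neq[symmetric])

text \<open>The term of the tested equation that contains the gradient of the cut-off.\<close>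

definition E :: "'a \<Rightarrow> real \<Rightarrow> 'a \<Rightarrow> real" where
  "E e R x = 2 * \<eta> R x * arctan (Z x \<bullet> e) * (H (Z x) (D x e) \<bullet> \<eta>' R x)"

lemma E_cont: "continuous_on UNIV (E e R)"
  unfolding E_def
  by (intro continuous_intros continuous_H Z_cont D_cont \<eta>_cont \<eta>'_cont)

lemma integrable_support:
  fixes f :: "'a \<Rightarrow> real"
  assumes "R > 0" "continuous_on UNIV f" "\<And>x. \<eta> R x = 0 \<Longrightarrow> f x = 0"
  shows "integrable lborel f"
  using assms \<eta>_support[OF assms(1)] by (intro integrable_compact_support[where R = "2 * R"]) auto

lemma integrable_\<eta>Q: "R > 0 \<Longrightarrow> integrable lborel (\<lambda>x. (\<eta> R x)\<^sup>2 * Q e x)"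
  by (rule integrable_support) (auto intro!: continuous_intros \<eta>_cont Q_cont)

lemma integrable_E: "R > 0 \<Longrightarrow> integrable lborel (E e R)"
  by (rule integrable_support[OF _ E_cont]) (auto simp: E_def)

lemma integrable_\<eta>_area: "R > 0 \<Longrightarrow> integrable lborel (\<lambda>x. \<eta> R x * (1 + norm (Z x)))"
  by (rule integrable_support) (auto intro!: continuous_intros \<eta>_cont Z_cont)

lemma tested_equation:
  assumes R: "R > 0"
  shows "(\<integral>x. (\<eta> R x)\<^sup>2 * Q e x \<partial>lborel) = (\<integral>x. - E e R x \<partial>lborel)"
proof -
  have C: "C1_grad (\<lambda>x. arctan (Z x \<bullet> e)) (\<lambda>x. (1 / (1 + (Z x \<bullet> e)\<^sup>2)) *\<^sub>R D x e)"
  proof (rule C1_grad_compose[OF C1_grad_partial[OF u Z]])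
    show "(arctan has_real_derivative 1 / (1 + s\<^sup>2)) (at s)" for s
      using DERIV_arctan[of s] by (simp add: inverse_eq_divide)
    show "continuous_on UNIV (\<lambda>s::real. 1 / (1 + s\<^sup>2))"
      using one_plus_square_pos by (intro continuous_intros) (auto simp: less_imp_neq[symmetric])
  qed
  let ?p' = "\<lambda>x. (\<eta> R x * \<eta> R x) *\<^sub>R ((1 / (1 + (Z x \<bullet> e)\<^sup>2)) *\<^sub>R D x e)
    + arctan (Z x \<bullet> e) *\<^sub>R (\<eta> R x *\<^sub>R \<eta>' R x + \<eta> R x *\<^sub>R \<eta>' R x)"
  have "(\<integral>x. H (Z x) (D x e) \<bullet> ?p' x \<partial>lborel) = 0"
    by (rule integral_derivative_divergence_free[OF C1_field_flux equation
          C1_grad_mult[OF C1_grad_mult[OF C1_grad_\<eta> C1_grad_\<eta>] C], where R = "2 * R"])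
       (simp add: \<eta>_support[OF R])
  also have "(\<lambda>x. H (Z x) (D x e) \<bullet> ?p' x) = (\<lambda>x. (\<eta> R x)\<^sup>2 * Q e x + E e R x)"
    by (rule ext) (simp add: Q_def E_def inner_add_right power2_eq_square algebra_simps)
  finally show ?thesis
    using integrable_\<eta>Q[OF R] integrable_E[OF R] by simp
qed

lemma \<eta>'_energy:
  assumes R: "R > 0"
  shows "H (Z x) (\<eta>' R x) \<bullet> \<eta>' R x \<le> 256 * c / (R\<^sup>2 * (1 + norm (Z x)))"
proof (cases "\<rho> x \<ge> 2 * R\<^sup>2")
  case True
  have "H (Z x) 0 = 0" using linear_0[OF linear_H] .
  then show ?thesis
    using \<eta>'_eq_0[OF R] True c_pos by (simp add: add_nonneg_nonneg)
next
  case False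
  let ?\<xi> = "x + u x *\<^sub>R Z x"
  define a where "a = 2 * cut' (\<rho> x / R\<^sup>2) / R\<^sup>2"
  have \<eta>': "\<eta>' R x = a *\<^sub>R ?\<xi>"
    by (simp add: \<eta>'_def a_def mult.commute)
  have "H (Z x) (\<eta>' R x) \<bullet> \<eta>' R x = a\<^sup>2 * (H (Z x) ?\<xi> \<bullet> ?\<xi>)"
    unfolding \<eta>' linear_scale[OF linear_H] by (simp add: power2_eq_square)
  also have "\<dots> \<le> (8 / R\<^sup>2)\<^sup>2 * (2 * c * \<rho> x / (1 + norm (Z x)))"
  proof (rule mult_mono)
    have "\<bar>a\<bar> \<le> 8 / R\<^sup>2"
      using cut'_le[of "\<rho> x / R\<^sup>2"] R unfolding a_def abs_divide abs_mult by (simp add: divide_right_mono)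
    then show "a\<^sup>2 \<le> (8 / R\<^sup>2)\<^sup>2"
      by (metis abs_ge_zero power2_abs power_mono)
    show "H (Z x) ?\<xi> \<bullet> ?\<xi> \<le> 2 * c * \<rho> x / (1 + norm (Z x))"
      using H_radial_le[of "Z x" x "u x"] by (simp add: \<rho>_def)
  qed (auto intro: H_nonneg)
  also have "\<dots> \<le> (8 / R\<^sup>2)\<^sup>2 * (2 * c * (2 * R\<^sup>2) / (1 + norm (Z x)))"
    using False c_pos by (intro mult_left_mono divide_right_mono) auto
  also have "\<dots> = 256 * c / (R\<^sup>2 * (1 + norm (Z x)))"
    using R by (simp add: field_simps power2_eq_square add_nonneg_eq_0_iff)
  finally show ?thesis .
qed

text \<open>The bound for \<open>\<eta>' R\<close> gains a factor \<open>1 / (1 + \<bar>Z\<bar>)\<close>, and the weight \<open>1 + (\<partial>\<^sub>e u)\<^sup>2\<close> costs the square of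
  \<open>1 + \<bar>Z\<bar>\<close>. The remaining factor \<open>1 + \<bar>Z\<bar>\<close> is the one in the area integral.\<close>

lemma E_le:
  assumes R: "R > 0" and e: "e \<in> Basis" and \<epsilon>: "\<epsilon> > 0"
  shows "\<bar>E e R x\<bar> \<le> \<epsilon> * ((\<eta> R x)\<^sup>2 * Q e x) + 1024 * c / (\<epsilon> * R\<^sup>2) * (\<eta> (2 * R) x * (1 + norm (Z x)))"
proof (cases "\<rho> x \<ge> 2 * R\<^sup>2")
  case True
  then show ?thesis
    using \<eta>_eq_0[OF R True] \<eta>_bounds[of "2 * R" x] c_pos \<epsilon> R
    by (simp add: E_def add_nonneg_nonneg)
next
  case False
  have one: "\<eta> (2 * R) x = 1"
    using False R by (intro \<eta>_eq_1) (auto simp: power_mult_distrib intro: order_trans[of _ "2 * R\<^sup>2"])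
  let ?z = "Z x \<bullet> e" and ?t = "norm (Z x)"
  define w where "w = 1 + ?z\<^sup>2"
  define \<psi> where "\<psi> = arctan ?z"
  define A where "A = H (Z x) (D x e) \<bullet> D x e"
  define B where "B = H (Z x) (\<eta>' R x) \<bullet> \<eta>' R x"
  have w: "w > 0" unfolding w_def by (rule one_plus_square_pos)
  \<comment> \<open>The weight \<open>w\<close> is moved to the factor with \<open>\<eta>'\<close> before Young's inequality is applied, so that
    the other factor produces \<open>Q e\<close>.\<close>
  have "\<bar>E e R x\<bar> = (1 / w) * (2 * \<bar>H (Z x) (\<eta> R x *\<^sub>R D x e) \<bullet> ((\<psi> * w) *\<^sub>R \<eta>' R x)\<bar>)"
    unfolding E_def linear_scale[OF linear_H] using w
    by (simp add: abs_mult \<psi>_def)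
  also have "\<dots> \<le> (1 / w) * (\<epsilon> * (H (Z x) (\<eta> R x *\<^sub>R D x e) \<bullet> (\<eta> R x *\<^sub>R D x e))
      + (H (Z x) ((\<psi> * w) *\<^sub>R \<eta>' R x) \<bullet> ((\<psi> * w) *\<^sub>R \<eta>' R x)) / \<epsilon>)"
    using w by (intro mult_left_mono H_Young \<epsilon>) simp
  also have "\<dots> = \<epsilon> * ((\<eta> R x)\<^sup>2 * ((1 / w) * A)) + (\<psi>\<^sup>2 * w * B) / \<epsilon>"
    unfolding linear_scale[OF linear_H] using w \<epsilon>
    by (simp add: A_def B_def field_simps power2_eq_square)
  also have "(1 / w) * A = Q e x"
    by (simp add: Q_def w_def A_def)
  also have "(\<psi>\<^sup>2 * w * B) / \<epsilon> \<le> (4 * (1 + ?t)\<^sup>2 * (256 * c / (R\<^sup>2 * (1 + ?t)))) / \<epsilon>"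
  proof (intro divide_right_mono mult_mono)
    have "\<bar>\<psi>\<bar> \<le> 2"
      using arctan_bounded[of ?z] pi_less_4 by (auto simp: \<psi>_def)
    then have "\<bar>\<psi>\<bar>\<^sup>2 \<le> 2\<^sup>2" by (intro power_mono) auto
    then show "\<psi>\<^sup>2 \<le> 4" by simp
    have "\<bar>?z\<bar> \<le> ?t"
      using Cauchy_Schwarz_ineq2[of "Z x" e] e by simp
    then have "\<bar>?z\<bar>\<^sup>2 \<le> ?t\<^sup>2" by (intro power_mono) auto
    then show "w \<le> (1 + ?t)\<^sup>2"
      by (auto simp: w_def power2_sum intro: order_trans)
    show "B \<le> 256 * c / (R\<^sup>2 * (1 + ?t))"
      unfolding B_def by (rule \<eta>'_energy[OF R])
  qed (use w \<epsilon> H_nonneg B_def in auto)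
  also have "(4 * (1 + ?t)\<^sup>2 * (256 * c / (R\<^sup>2 * (1 + ?t)))) / \<epsilon> = 1024 * c / (\<epsilon> * R\<^sup>2) * (1 * (1 + ?t))"
    using R \<epsilon> by (simp add: field_simps power2_eq_square add_nonneg_eq_0_iff)
  finally show ?thesis
    unfolding one by simp
qed

text \<open>The gradient of \<open>\<eta> R\<close> lives in a shell where \<open>\<eta> (2 R) = 1\<close> and \<open>\<eta> (R / 2) = 0\<close>, so only the part
  of the Dirichlet integral over that shell enters on the right-hand side.\<close>

lemma E_le_shell:
  assumes R: "R > 0" and e: "e \<in> Basis" and \<epsilon>: "\<epsilon> > 0"
  shows "\<bar>E e R x\<bar> \<le> \<epsilon> * ((\<eta> (2 * R) x)\<^sup>2 * Q e x - (\<eta> (R / 2) x)\<^sup>2 * Q e x)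
    + 1024 * c / (\<epsilon> * R\<^sup>2) * (\<eta> (2 * R) x * (1 + norm (Z x)))"
proof -
  have P: "0 \<le> 1024 * c / (\<epsilon> * R\<^sup>2) * (\<eta> (2 * R) x * (1 + norm (Z x)))"
    using c_pos \<epsilon> R \<eta>_bounds[of "2 * R" x] by (intro mult_nonneg_nonneg) auto
  have R2: "(R / 2)\<^sup>2 = R\<^sup>2 / 4" "(2 * R)\<^sup>2 = 4 * R\<^sup>2" "R\<^sup>2 > 0"
    using R by (auto simp: power_divide power_mult_distrib)
  consider "\<rho> x \<le> R\<^sup>2" | "\<rho> x \<ge> 2 * R\<^sup>2" | "R\<^sup>2 < \<rho> x" "\<rho> x < 2 * R\<^sup>2" by linarith
  then show ?thesis
  proof cases
    case 1
    have "\<rho> x \<le> (2 * R)\<^sup>2"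
      using 1 R2(3) unfolding R2(2) by linarith
    then have "\<eta> (2 * R) x = 1"
      using R by (intro \<eta>_eq_1) auto
    moreover have "(\<eta> (R / 2) x)\<^sup>2 \<le> 1"
      using \<eta>_bounds[of "R / 2" x] by (intro power_le_one)
    then have "(\<eta> (R / 2) x)\<^sup>2 * Q e x \<le> 1 * Q e x"
      by (intro mult_right_mono Q_nonneg)
    ultimately have "0 \<le> \<epsilon> * ((\<eta> (2 * R) x)\<^sup>2 * Q e x - (\<eta> (R / 2) x)\<^sup>2 * Q e x)"
      using \<epsilon> by (intro mult_nonneg_nonneg) auto
    moreover have "E e R x = 0" using \<eta>'_eq_0[OF R] 1 by (simp add: E_def)
    ultimately show ?thesis using P by linarith
  next
    case 2
    have "\<rho> x \<ge> 2 * (R / 2)\<^sup>2"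
      using 2 R2(3) unfolding R2(1) by linarith
    then have "\<eta> (R / 2) x = 0"
      using R by (intro \<eta>_eq_0) auto
    then have "0 \<le> \<epsilon> * ((\<eta> (2 * R) x)\<^sup>2 * Q e x - (\<eta> (R / 2) x)\<^sup>2 * Q e x)"
      using \<epsilon> Q_nonneg[of e x] by simp
    moreover have "E e R x = 0" using \<eta>'_eq_0[OF R] 2 by (simp add: E_def)
    ultimately show ?thesis using P by linarith
  next
    case 3
    have "\<eta> (2 * R) x = 1" "\<eta> (R / 2) x = 0"
      using 3 R R2 by (auto intro!: \<eta>_eq_1 \<eta>_eq_0)
    moreover have "(\<eta> R x)\<^sup>2 \<le> 1"
      using \<eta>_bounds[of R x] by (intro power_le_one)
    then have "\<epsilon> * ((\<eta> R x)\<^sup>2 * Q e x) \<le> \<epsilon> * (1 * Q e x)"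
      using \<epsilon> by (intro mult_left_mono mult_right_mono Q_nonneg) auto
    ultimately show ?thesis
      using E_le[OF R e \<epsilon>, of x] by simp
  qed
qed

text \<open>The weighted Dirichlet integral of \<open>\<partial>\<^sub>e u\<close>, localized by \<open>\<eta> R\<close>.\<close>

definition energy :: "'a \<Rightarrow> real \<Rightarrow> real" where
  "energy e R = (\<integral>x. (\<eta> R x)\<^sup>2 * Q e x \<partial>lborel)"

text \<open>Absorbing the energy with the factor \<open>1 / 2\<close> gives the uniform bound; the second estimate is
  that of the shell.\<close>

lemma energy_estimates:
  assumes e: "e \<in> Basis"
  obtains K where "\<And>R. R > 0 \<Longrightarrow> energy e R \<le> K"
    and "\<And>R \<epsilon>. R > 0 \<Longrightarrow> \<epsilon> > 0 \<Longrightarrow> energy e R \<le> \<epsilon> * (energy e (2 * R) - energy e (R / 2)) + K / \<epsilon>"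
proof -
  obtain C where C: "C > 0" "\<And>R. R > 0 \<Longrightarrow> (\<integral>x. \<eta> R x * (1 + norm (Z x)) \<partial>lborel) \<le> C * R\<^sup>2"
    using area_growth by metis
  define K where "K = 4096 * c * C"
  have K0: "K > 0" using C(1) c_pos by (simp add: K_def)
  have area: "1024 * c / (\<epsilon> * R\<^sup>2) * (\<integral>x. \<eta> (2 * R) x * (1 + norm (Z x)) \<partial>lborel) \<le> K / \<epsilon>"
    if "R > 0" "\<epsilon> > 0" for R \<epsilon>
  proof -
    have "1024 * c / (\<epsilon> * R\<^sup>2) * (\<integral>x. \<eta> (2 * R) x * (1 + norm (Z x)) \<partial>lborel)
        \<le> 1024 * c / (\<epsilon> * R\<^sup>2) * (C * (2 * R)\<^sup>2)"
      using that c_pos by (intro mult_left_mono C) auto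
    also have "\<dots> = K / \<epsilon>"
      using that by (simp add: K_def power_mult_distrib field_simps)
    finally show ?thesis .
  qed
  have bound: "energy e R \<le> 4 * K" if R: "R > 0" for R
  proof -
    have "energy e R \<le> (\<integral>x. 1/2 * ((\<eta> R x)\<^sup>2 * Q e x) + 1024 * c / (1/2 * R\<^sup>2) * (\<eta> (2 * R) x * (1 + norm (Z x))) \<partial>lborel)"
      unfolding energy_def tested_equation[OF R]
    proof (rule integral_mono)
      show "- E e R x \<le> 1/2 * ((\<eta> R x)\<^sup>2 * Q e x) + 1024 * c / (1/2 * R\<^sup>2) * (\<eta> (2 * R) x * (1 + norm (Z x)))" for x
        using E_le[OF R e, of "1/2" x] by linarith
      show "integrable lborel (\<lambda>x. 1/2 * ((\<eta> R x)\<^sup>2 * Q e x) + 1024 * c / (1/2 * R\<^sup>2) * (\<eta> (2 * R) x * (1 + norm (Z x))))"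
        using R by (intro Bochner_Integration.integrable_add integrable_mult_right integrable_\<eta>Q integrable_\<eta>_area) auto
    qed (use integrable_E[OF R] in simp)
    also have "\<dots> = 1/2 * energy e R + 1024 * c / (1/2 * R\<^sup>2) * (\<integral>x. \<eta> (2 * R) x * (1 + norm (Z x)) \<partial>lborel)"
      unfolding energy_def using R integrable_\<eta>Q[OF R, of e] integrable_\<eta>_area[of "2 * R"]
      by (subst Bochner_Integration.integral_add) auto
    also have "\<dots> \<le> 1/2 * energy e R + K / (1/2)"
      using R by (intro add_left_mono area) auto
    finally show ?thesis by simp
  qed
  have shell: "energy e R \<le> \<epsilon> * (energy e (2 * R) - energy e (R / 2)) + K / \<epsilon>"
    if R: "R > 0" and \<epsilon>: "\<epsilon> > 0" for R \<epsilon>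
  proof -
    let ?f = "\<lambda>x. \<epsilon> * ((\<eta> (2 * R) x)\<^sup>2 * Q e x - (\<eta> (R / 2) x)\<^sup>2 * Q e x)"
    let ?g = "\<lambda>x. 1024 * c / (\<epsilon> * R\<^sup>2) * (\<eta> (2 * R) x * (1 + norm (Z x)))"
    have int: "integrable lborel ?f" "integrable lborel ?g"
      using R by (auto intro!: integrable_mult_right Bochner_Integration.integrable_diff integrable_\<eta>Q integrable_\<eta>_area)
    have "energy e R \<le> (\<integral>x. ?f x + ?g x \<partial>lborel)"
      unfolding energy_def tested_equation[OF R]
    proof (rule integral_mono)
      show "- E e R x \<le> ?f x + ?g x" for x
        using E_le_shell[OF R e \<epsilon>, of x] by linarith
      show "integrable lborel (\<lambda>x. ?f x + ?g x)"
        by (intro Bochner_Integration.integrable_add int)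
    qed (use integrable_E[OF R] in simp)
    also have "\<dots> = (\<integral>x. ?f x \<partial>lborel) + (\<integral>x. ?g x \<partial>lborel)"
      by (rule Bochner_Integration.integral_add[OF int])
    also have "(\<integral>x. ?f x \<partial>lborel) = \<epsilon> * (energy e (2 * R) - energy e (R / 2))"
      unfolding energy_def using R
      by (subst Bochner_Integration.integral_diff[symmetric]) (auto intro!: integrable_\<eta>Q)
    also have "(\<integral>x. ?g x \<partial>lborel) \<le> K / \<epsilon>"
      using area[OF R \<epsilon>] by simp
    finally show ?thesis by simp
  qed
  show thesis
  proof (rule that[of "4 * K"])
    show "energy e R \<le> 4 * K" if "R > 0" for R
      using bound[OF that] .
    show "energy e R \<le> \<epsilon> * (energy e (2 * R) - energy e (R / 2)) + 4 * K / \<epsilon>" if "R > 0" "\<epsilon> > 0" for R \<epsilon>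
    proof -
      have "K / \<epsilon> \<le> 4 * K / \<epsilon>" using K0 that by (intro divide_right_mono) auto
      then show ?thesis using shell[OF that] by linarith
    qed
  qed
qed

lemma energy_nonneg: "0 \<le> energy e R"
  unfolding energy_def by (intro Bochner_Integration.integral_nonneg) (auto intro!: mult_nonneg_nonneg Q_nonneg)

lemma energy_mono_double:
  assumes R: "R > 0"
  shows "energy e R \<le> energy e (2 * R)"
  unfolding energy_def
proof (rule integral_mono)
  fix x
  show "(\<eta> R x)\<^sup>2 * Q e x \<le> (\<eta> (2 * R) x)\<^sup>2 * Q e x"
  proof (cases "\<rho> x \<ge> 2 * R\<^sup>2")
    case True
    then show ?thesis
      using \<eta>_eq_0[OF R True] by (simp add: Q_nonneg)
  next
    case False
    then have "\<rho> x \<le> 4 * R\<^sup>2"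
      using zero_le_power2[of R] by linarith
    then have "\<eta> (2 * R) x = 1"
      using R by (intro \<eta>_eq_1) (auto simp: power_mult_distrib)
    moreover have "(\<eta> R x)\<^sup>2 \<le> 1"
      using \<eta>_bounds[of R x] by (intro power_le_one)
    ultimately show ?thesis
      by (intro mult_right_mono Q_nonneg) simp
  qed
qed (use R in \<open>auto intro!: integrable_\<eta>Q\<close>)

text \<open>The energies along \<open>R = 2\<^sup>n R\<^sub>0\<close> converge, so the shell terms tend to \<open>0\<close>. What remains is
  \<open>K / \<epsilon>\<close> with arbitrarily large \<open>\<epsilon>\<close>.\<close>

lemma energy_zero:
  assumes e: "e \<in> Basis" and R0: "R\<^sub>0 > 0"
  shows "energy e R\<^sub>0 = 0"
proof -
  obtain K where K: "\<And>R. R > 0 \<Longrightarrow> energy e R \<le> K"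
    "\<And>R \<epsilon>. R > 0 \<Longrightarrow> \<epsilon> > 0 \<Longrightarrow> energy e R \<le> \<epsilon> * (energy e (2 * R) - energy e (R / 2)) + K / \<epsilon>"
    using energy_estimates[OF e] by metis
  define I where "I n = energy e (2 ^ n * R\<^sub>0)" for n
  have R: "2 ^ n * R\<^sub>0 > 0" for n using R0 by simp
  have inc: "incseq I"
    using energy_mono_double[OF R] by (intro incseq_SucI) (simp add: I_def mult.assoc)
  then obtain L where L: "I \<longlonglongrightarrow> L" "\<And>n. I n \<le> L"
    using incseq_convergent[of I K] K(1)[OF R] unfolding I_def by blast
  have "L \<le> K / \<epsilon>" if \<epsilon>: "\<epsilon> > 0" for \<epsilon>
  proof (rule LIMSEQ_le)
    show "(\<lambda>n. I (Suc n)) \<longlonglongrightarrow> L" using L(1) by (rule LIMSEQ_Suc)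
    have "(\<lambda>n. \<epsilon> * (I (Suc (Suc n)) - I n) + K / \<epsilon>) \<longlonglongrightarrow> \<epsilon> * (L - L) + K / \<epsilon>"
      by (intro tendsto_intros LIMSEQ_Suc L(1))
    then show "(\<lambda>n. \<epsilon> * (I (Suc (Suc n)) - I n) + K / \<epsilon>) \<longlonglongrightarrow> K / \<epsilon>" by simp
    have "I (Suc n) \<le> \<epsilon> * (I (Suc (Suc n)) - I n) + K / \<epsilon>" for n
      using K(2)[OF R[of "Suc n"] \<epsilon>] by (simp add: I_def mult.assoc)
    then show "\<exists>N. \<forall>n\<ge>N. I (Suc n) \<le> \<epsilon> * (I (Suc (Suc n)) - I n) + K / \<epsilon>" by blast
  qed
  moreover have "((\<lambda>\<epsilon>. K / \<epsilon>) \<longlongrightarrow> 0) at_top"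
    by (intro tendsto_divide_0[OF tendsto_const] filterlim_at_top_imp_at_infinity filterlim_ident)
  ultimately have "L \<le> 0"
    by (intro tendsto_lowerbound[of "\<lambda>\<epsilon>. K / \<epsilon>" 0 at_top L])
       (auto intro: eventually_mono[OF eventually_gt_at_top[of 0]])
  then show ?thesis
    using L(2)[of 0] energy_nonneg[of e R\<^sub>0] by (simp add: I_def)
qed

section \<open>Solutions of zero energy\<close>

lemma hessian_zero:
  assumes "Z x \<noteq> 0"
  shows "D x h = 0"
proof -
  have "D x e = 0" if e: "e \<in> Basis" for e
  proof -
    \<comment> \<open>With this radius, the cut-off equals \<open>1\<close> at \<open>x\<close>.\<close>
    define R where "R = 1 + \<rho> x"
    have \<rho>0: "\<rho> x \<ge> 0" by (simp add: \<rho>_def)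
    then have R: "R > 0" by (simp add: R_def)
    have "\<rho> x \<le> R\<^sup>2"
      using \<rho>0 unfolding R_def power2_sum by (simp add: add_increasing2)
    then have 1: "\<eta> R x = 1" by (intro \<eta>_eq_1 R)
    have "(\<eta> R x)\<^sup>2 * Q e x = 0"
    proof (rule continuous_integral_zero[where R = "2 * R" and f = "\<lambda>x. (\<eta> R x)\<^sup>2 * Q e x"])
      show "continuous_on UNIV (\<lambda>x. (\<eta> R x)\<^sup>2 * Q e x)"
        by (intro continuous_intros \<eta>_cont Q_cont)
      show "(\<integral>x. (\<eta> R x)\<^sup>2 * Q e x \<partial>lborel) = 0"
        using energy_zero[OF e R] by (simp add: energy_def)
    qed (auto simp: \<eta>_support[OF R] intro!: mult_nonneg_nonneg Q_nonneg)
    then have "H (Z x) (D x e) \<bullet> D x e = 0"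
      using 1 one_plus_square_pos[of "Z x \<bullet> e"] by (simp add: Q_def)
    then show ?thesis using H_pos assms by blast
  qed
  moreover have "linear (D x)"
    using Z unfolding C1_field_def by (metis has_derivative_bounded_linear bounded_linear.linear)
  ultimately show ?thesis
    using linear_eq_on_span[of "D x" "\<lambda>_. 0" Basis h] by (auto simp: linear_zero)
qed

text \<open>The Hessian might a priori be nonzero at critical points of \<open>u\<close>. But \<open>\<bar>\<nabla>u\<bar>\<^sup>2\<close> has derivative
  \<open>2 \<nabla>u \<bullet> D\<^sup>2u = 0\<close> everywhere, hence it is constant, and critical points do not occur unless \<open>u\<close> is
  constant.\<close>

lemma solution_affine: "\<exists>A a. \<forall>x. u x = A \<bullet> x + a"
proof -
  have Zd: "(Z has_derivative D x) (at x)" for x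
    using Z by (simp add: C1_field_def)
  have "((\<lambda>x. Z x \<bullet> Z x) has_derivative (\<lambda>h. 0)) (at x)" for x
  proof -
    have "((\<lambda>x. Z x \<bullet> Z x) has_derivative (\<lambda>h. Z x \<bullet> D x h + D x h \<bullet> Z x)) (at x)"
      by (rule has_derivative_inner[OF Zd Zd])
    moreover have "Z x \<bullet> D x h + D x h \<bullet> Z x = 0" for h
      using hessian_zero[of x h] by (cases "Z x = 0") auto
    ultimately show ?thesis by simp
  qed
  then obtain s where s: "\<And>x. Z x \<bullet> Z x = s"
    using has_derivative_zero_constant[of UNIV "\<lambda>x. Z x \<bullet> Z x"] by auto
  have "\<exists>A. \<forall>x. Z x = A"
  proof (cases "s = 0")
    case True
    then show ?thesis using s by auto
  next
    case False
    then have "D x h = 0" for x h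
      using s[of x] by (intro hessian_zero) auto
    then have "D x = (\<lambda>h. 0)" for x by auto
    then have "(Z has_derivative (\<lambda>h. 0)) (at x)" for x
      using Zd[of x] by simp
    then show ?thesis
      using has_derivative_zero_constant[of UNIV Z] by auto
  qed
  then obtain A where A: "\<And>x. Z x = A" by blast
  have "((\<lambda>x. u x - A \<bullet> x) has_derivative (\<lambda>h. h \<bullet> A - A \<bullet> h)) (at x)" for x
    using u A by (intro has_derivative_diff has_derivative_inner_right has_derivative_ident)
      (simp add: C1_grad_def gderiv_def)
  then have "((\<lambda>x. u x - A \<bullet> x) has_derivative (\<lambda>h. 0)) (at x)" for x
    by (simp add: inner_commute)
  then obtain a where "\<And>x. u x - A \<bullet> x = a"
    using has_derivative_zero_constant[of UNIV "\<lambda>x. u x - A \<bullet> x"] by auto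
  then have "\<forall>x. u x = A \<bullet> x + a" by (metis diff_add_cancel add.commute)
  then show ?thesis by blast
qed

end

theorem theorem1p2:
  fixes g g' g'' :: "real \<Rightarrow> real"
    and a\<^sub>1 a\<^sub>2 a\<^sub>3 a\<^sub>4 a\<^sub>5 \<mu> :: real
    and F u :: "real ^ 2 \<Rightarrow> real"
  assumes g_deriv: "\<And>t. t \<ge> 0 \<Longrightarrow> (g has_real_derivative g' t) (at t within {0..})"
    and g'_deriv: "\<And>t. t \<ge> 0 \<Longrightarrow> (g' has_real_derivative g'' t) (at t within {0..})"
    and g''_cont: "continuous_on {0..} g''"
    and a_mu: "a\<^sub>1 > 0" "a\<^sub>3 > 0" "a\<^sub>5 > 0" "a\<^sub>2 \<ge> 0" "a\<^sub>4 \<ge> 0" "\<mu> \<ge> 1"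
    and g'_0: "g' 0 = 0"
    and g''_pos: "\<And>t. t > 0 \<Longrightarrow> g'' t > 0"
    and g_lower: "\<And>t. t \<ge> 0 \<Longrightarrow> a\<^sub>1 * t - a\<^sub>2 \<le> g t"
    and g_upper: "\<And>t. t \<ge> 0 \<Longrightarrow> g t \<le> a\<^sub>3 * t + a\<^sub>4"
    and g''_bound: "\<And>t. t \<ge> 0 \<Longrightarrow> g'' t \<le> a\<^sub>5 * (1 + t) powr (- \<mu>)"
    and F_eq: "\<And>Z. F Z = g (norm Z)"
    and u_C2: "class_C2 u"
    and u_sol: "\<And>x. divergence (\<lambda>y. grad F (grad u y)) x = 0"
    and mu_ge_3: "\<mu> \<ge> 3"
  shows "\<exists>(A :: real ^ 2) (a :: real). \<forall>x. u x = A \<bullet> x + a"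
proof -
  interpret radial_integrand g' g'' a\<^sub>5
  proof
    fix t :: real assume t: "t \<ge> 0"
    have "(1 + t) powr (- \<mu>) \<le> (1 + t) powr (- 3)"
      using t mu_ge_3 by (intro powr_mono) auto
    also have "\<dots> = 1 / (1 + t) ^ 3"
      using t powr_realpow[of "1 + t" 3] by (simp add: powr_minus inverse_eq_divide)
    finally have "a\<^sub>5 * (1 + t) powr (- \<mu>) \<le> a\<^sub>5 * (1 / (1 + t) ^ 3)"
      using a_mu(3) by (intro mult_left_mono) auto
    then show "g'' t \<le> a\<^sub>5 / (1 + t) ^ 3"
      using g''_bound[OF t] by simp
  qed (use g'_deriv g''_cont g'_0 g''_pos in auto)
  obtain Z D where u: "C1_grad u Z" and Z: "C1_field Z D"
    using class_C2_gradient_hessian[OF u_C2] .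
  have flux: "(\<lambda>y. grad F (grad u y)) = (\<lambda>y. G (Z y))"
  proof
    fix y
    have "grad u y = Z y"
      using u by (intro grad_eqI) (simp add: C1_grad_def)
    then show "grad F (grad u y) = G (Z y)"
      by (simp add: grad_radial[OF g_deriv F_eq])
  qed
  have "(\<Sum>b\<in>Basis. H (Z x) (D x b) \<bullet> b) = 0" for x
  proof -
    have "((\<lambda>y. G (Z y)) has_derivative (\<lambda>h. H (Z x) (D x h))) (at x)"
      by (rule has_derivative_compose[OF _ G_has_derivative]) (use Z in \<open>simp add: C1_field_def\<close>)
    then have "frechet_derivative (\<lambda>y. G (Z y)) (at x) = (\<lambda>h. H (Z x) (D x h))"
      by (rule frechet_derivative_at[symmetric])
    then show ?thesis
      using u_sol[of x] unfolding flux divergence_def by simp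
  qed
  then interpret entire_solution g' g'' a\<^sub>5 u Z D
    by unfold_locales (use u Z in auto)
  show ?thesis by (rule solution_affine)
qed

end
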